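(* Let $n\ge 1$ and $f,g\in\mathrm{SBW}_n$. For all $a,b,e,h\in\mathrm{P}[n]$ the following identities hold: 1. $$(fg)_{m,s}(a,b)=\sum_{c\in\mathrm{P}[n]}f_{m,s}(a,c)\,g_{m,s}(a+c,b+c).$$ 2. $$(fg)_{x,s}(e,h)=\sum_{a\subseteq e,\ b,c\in\mathrm{P}[n]}O\big\{k\subseteq b\cap c\ \big|\ a\cup(c\setminus k)=e\big\}\,f_{x,s}(a,b)\,g_{x,s}(c,b+h),$$ where the sum runs over all $a,b,c\in\mathrm{P}[n]$ with $a\subseteq e$.
   Context: $\mathbb{Z}_2=\{0,1\}$ is the field with two elements, $[n]=\{1,\dots,n\}$, $\mathrm{P}[n]$ is the set of subsets of $[n]$; for $a,b\in\mathrm{P}[n]$, $a+b=(a\cup b)\setminus(a\cap b)$ is the symmetric difference and $\overline a=[n]\setminus a$. For a finite set $S$, $O S\in\mathbb{Z}_2$ is $1$ if $|S|$ is odd and $0$ otherwise. The shifted Boole-Weyl algebra $\mathrm{SBW}_n$ is the quotient of the free associative $\mathbb{Z}_2$-algebra $\mathbb{Z}_2\langle x_1,\dots,x_n,s_1,\dots,s_n\rangle$ by the two-sided ideal generated by $x_i^2+x_i$, $s_i^2+1$, $s_ix_i+x_is_i+s_i$ for $i\in[n]$; $x_ix_j+x_jx_i$, $s_is_j+s_js_i$ for $i,j\in[n]$; and $s_ix_j+x_js_i$ for $i\neq j\in[n]$. For $a\in\mathrm{P}[n]$ put in $\mathrm{SBW}_n$: $x^a=\prod_{i\in a}x_i$,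 $s^a=\prod_{i\in a}s_i$, $m^a=\prod_{i\in a}x_i\prod_{i\in\overline a}(x_i+1)$ (empty products are $1$). Both $\{m^as^b\mid a,b\in\mathrm{P}[n]\}$ and $\{x^as^b\mid a,b\in\mathrm{P}[n]\}$ are bases of the $\mathbb{Z}_2$-vector space $\mathrm{SBW}_n$, and the coordinates $f_{m,s}(a,b),f_{x,s}(a,b)\in\mathbb{Z}_2$ of $f\in\mathrm{SBW}_n$ are defined by $f=\sum_{a,b}f_{m,s}(a,b)m^as^b=\sum_{a,b}f_{x,s}(a,b)x^as^b$. *)

theory Defs
  imports
    "HOL-Algebra.QuotRing"
    "HOL-Library.Poly_Mapping"
    "HOL-Library.Z2"
begin

text \<open>
  The free associative algebra over the two-element field \<^typ>\<open>bit\<close> is the monoid algebra of the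
  free monoid: finitely supported functions from words to \<^typ>\<open>bit\<close> with the convolution product
  of \<^theory>\<open>HOL-Library.Poly_Mapping\<close>. That product expects the monoid of exponents to be
  written additively, so concatenation of words is \<open>+\<close> and the empty word is \<open>0\<close>. Words get a type
  of their own because other theories order and add lists differently.
\<close>

datatype gen = GX nat | GS nat

datatype 'a word = Word (letters: "'a list")

instantiation word :: (type) monoid_add
begin

definition zero_word :: "'a word"
  where "0 = Word []"

definition plus_word :: "'a word \<Rightarrow> 'a word \<Rightarrow> 'a word"
  where "u + v = Word (letters u @ letters v)"

instance
  by standard (simp_all add: zero_word_def plus_word_def)

end

definition gens :: "nat \<Rightarrow> gen set"
  where "gens n = GX ` {1..n} \<union> GS ` {1..n}"

definition free_alg :: "nat \<Rightarrow> (gen word \<Rightarrow>\<^sub>0 bit) ring"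
  where "free_alg n =
    \<lparr>carrier = {p. \<forall>w \<in> Poly_Mapping.keys p. set (letters w) \<subseteq> gens n},
     mult = (*), one = 1, zero = 0, add = (+)\<rparr>"

definition free_x :: "nat \<Rightarrow> gen word \<Rightarrow>\<^sub>0 bit"
  where "free_x i = Poly_Mapping.single (Word [GX i]) 1"

definition free_s :: "nat \<Rightarrow> gen word \<Rightarrow>\<^sub>0 bit"
  where "free_s i = Poly_Mapping.single (Word [GS i]) 1"

definition sbw_relations :: "nat \<Rightarrow> (gen word \<Rightarrow>\<^sub>0 bit) set"
  where "sbw_relations n =
    {free_x i * free_x i + free_x i | i. i \<in> {1..n}} \<union>
    {free_s i * free_s i + 1 | i. i \<in> {1..n}} \<union>
    {free_s i * free_x i + free_x i * free_s i + free_s i | i. i \<in> {1..n}} \<union>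
    {free_x i * free_x j + free_x j * free_x i | i j. i \<in> {1..n} \<and> j \<in> {1..n}} \<union>
    {free_s i * free_s j + free_s j * free_s i | i j. i \<in> {1..n} \<and> j \<in> {1..n}} \<union>
    {free_s i * free_x j + free_x j * free_s i | i j. i \<in> {1..n} \<and> j \<in> {1..n} \<and> i \<noteq> j}"

definition sbw_ideal :: "nat \<Rightarrow> (gen word \<Rightarrow>\<^sub>0 bit) set"
  where "sbw_ideal n = Idl\<^bsub>free_alg n\<^esub> (sbw_relations n)"

definition SBW :: "nat \<Rightarrow> (gen word \<Rightarrow>\<^sub>0 bit) set ring"
  where "SBW n = free_alg n Quot sbw_ideal n"

definition sbw_x :: "nat \<Rightarrow> nat \<Rightarrow> (gen word \<Rightarrow>\<^sub>0 bit) set"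
  where "sbw_x n i = sbw_ideal n +>\<^bsub>free_alg n\<^esub> free_x i"

definition sbw_s :: "nat \<Rightarrow> nat \<Rightarrow> (gen word \<Rightarrow>\<^sub>0 bit) set"
  where "sbw_s n i = sbw_ideal n +>\<^bsub>free_alg n\<^esub> free_s i"

text \<open>
  \<open>SBW n\<close> is not commutative, so \<^const>\<open>finprod\<close> does not apply; the product over a finite set of
  indices is taken in increasing order. In each use below the factors commute.
\<close>

definition ordered_prod :: "('a, 'm) monoid_scheme \<Rightarrow> (nat \<Rightarrow> 'a) \<Rightarrow> nat set \<Rightarrow> 'a"
  where "ordered_prod R f a = foldr (\<lambda>i y. f i \<otimes>\<^bsub>R\<^esub> y) (sorted_list_of_set a) \<one>\<^bsub>R\<^esub>"

definition x_pow :: "nat \<Rightarrow> nat set \<Rightarrow> (gen word \<Rightarrow>\<^sub>0 bit) set"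
  where "x_pow n a = ordered_prod (SBW n) (sbw_x n) a"

definition s_pow :: "nat \<Rightarrow> nat set \<Rightarrow> (gen word \<Rightarrow>\<^sub>0 bit) set"
  where "s_pow n a = ordered_prod (SBW n) (sbw_s n) a"

definition m_pow :: "nat \<Rightarrow> nat set \<Rightarrow> (gen word \<Rightarrow>\<^sub>0 bit) set"
  where "m_pow n a =
    ordered_prod (SBW n) (sbw_x n) a \<otimes>\<^bsub>SBW n\<^esub>
    ordered_prod (SBW n) (\<lambda>i. sbw_x n i \<oplus>\<^bsub>SBW n\<^esub> \<one>\<^bsub>SBW n\<^esub>) ({1..n} - a)"

definition bit_scale :: "('a, 'm) ring_scheme \<Rightarrow> bit \<Rightarrow> 'a \<Rightarrow> 'a"
  where "bit_scale R c v = (if c = 1 then v else \<zero>\<^bsub>R\<^esub>)"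

text \<open>
  The coordinates of \<open>f\<close> with respect to a family \<open>B\<close> indexed by pairs of subsets of \<open>{1..n}\<close>.
  Restricting to extensional functions makes the coordinate function unique when \<open>B\<close> is a basis.
\<close>

definition coords ::
  "nat \<Rightarrow> (nat set \<Rightarrow> nat set \<Rightarrow> (gen word \<Rightarrow>\<^sub>0 bit) set) \<Rightarrow> (gen word \<Rightarrow>\<^sub>0 bit) set
    \<Rightarrow> nat set \<times> nat set \<Rightarrow> bit"
  where "coords n B f =
    (THE F. F \<in> Pow {1..n} \<times> Pow {1..n} \<rightarrow>\<^sub>E UNIV \<and>
      f = (\<Oplus>\<^bsub>SBW n\<^esub>a \<in> Pow {1..n}. \<Oplus>\<^bsub>SBW n\<^esub>b \<in> Pow {1..n}.
        bit_scale (SBW n) (F (a, b)) (B a b)))"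

definition coord_ms :: "nat \<Rightarrow> (gen word \<Rightarrow>\<^sub>0 bit) set \<Rightarrow> nat set \<Rightarrow> nat set \<Rightarrow> bit"
  where "coord_ms n f a b = coords n (\<lambda>a b. m_pow n a \<otimes>\<^bsub>SBW n\<^esub> s_pow n b) f (a, b)"

definition coord_xs :: "nat \<Rightarrow> (gen word \<Rightarrow>\<^sub>0 bit) set \<Rightarrow> nat set \<Rightarrow> nat set \<Rightarrow> bit"
  where "coord_xs n f a b = coords n (\<lambda>a b. x_pow n a \<otimes>\<^bsub>SBW n\<^esub> s_pow n b) f (a, b)"

definition odd_card :: "'a set \<Rightarrow> bit"
  where "odd_card A = (if odd (card A) then 1 else 0)"

end

theory Submission
  imports Defs
begin

text \<open>
  The algebra acts on functions \<open>\<phi>\<close> from the subsets of \<open>{1..n}\<close> to the two-element field: \<open>x\<^sub>i\<close>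
  multiplies \<open>\<phi>\<close> by the indicator of \<open>i \<in> u\<close>, and \<open>s\<^sub>i\<close> replaces \<open>\<phi>(u)\<close> by \<open>\<phi>(u + {i})\<close>. All the
  relations hold for these operators. The element \<open>m\<^sup>a s\<^sup>b\<close> acts as a matrix unit,
  \<open>\<phi> \<mapsto> [u = a] \<phi>(u + b)\<close>, so the coordinate \<open>f\<^sub>m\<^sub>s(a, b)\<close> is the matrix entry of \<open>f\<close> in row \<open>a\<close> and
  column \<open>a + b\<close> (\<open>coord_ms_eq_act\<close>). The first formula is therefore matrix multiplication
  (\<open>coord_ms_mult\<close>).

  The coordinates are defined by a description that has a meaning only if both families are bases.
  Independence comes from the action, by evaluating on point functions. That the families span
  (\<open>ms_span\<close>, \<open>xs_span\<close>) is shown inside the ring: the span is stable under left multiplication by the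
  generators and contains \<open>1\<close>. For the minterms, \<open>x\<^sub>i m\<^sup>a\<close> is \<open>m\<^sup>a\<close> or \<open>0\<close>, \<open>s\<^sub>i\<close> moves past
  \<open>m\<^sup>a\<close> and turns it into the minterm of \<open>a + {i}\<close>, and \<open>1\<close> is the sum of all minterms because \<open>1 = x\<^sub>i + (x\<^sub>i + 1)\<close>.

  Since \<open>x\<^sup>a\<close> acts as multiplication by the indicator of \<open>a \<subseteq> u\<close>, the two kinds of coordinates are
  related by \<open>f\<^sub>m\<^sub>s(u, b) = (\<Sum>a \<subseteq> u. f\<^sub>x\<^sub>s(a, b))\<close>, a triangular and hence invertible system. It suffices to
  verify the second formula after summing over all \<open>e \<subseteq> u\<close>. There the parities add up to the parity
  of the number of \<open>k \<subseteq> b \<inter> c\<close> with \<open>a \<union> (c - k) \<subseteq> u\<close>, which is odd exactly when \<open>a \<subseteq> u\<close> and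
  \<open>c \<subseteq> u + b\<close> (\<open>odd_card_deletions\<close>); what remains is the first formula.
\<close>

\<comment> \<open>These rules rewrite the field operations of \<^typ>\<open>bit\<close> to bitwise ones, out of reach of the
  laws of rings and finite sums.\<close>
declare add_bit_eq_xor [simp del] mult_bit_eq_and [simp del]

section \<open>Products of commuting factors\<close>

lemma (in monoid) ordered_prod_empty [simp]: "ordered_prod G f {} = \<one>"
  by (simp add: ordered_prod_def)

lemma (in monoid) foldr_closed:
  assumes "\<And>i. i \<in> set is \<Longrightarrow> f i \<in> carrier G"
  shows "foldr (\<lambda>i y. f i \<otimes> y) is \<one> \<in> carrier G"
  using assms by (induction "is") auto

lemma (in monoid) ordered_prod_closed:
  assumes "finite A" "\<And>i. i \<in> A \<Longrightarrow> f i \<in> carrier G"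
  shows "ordered_prod G f A \<in> carrier G"
  using assms by (auto simp: ordered_prod_def intro!: foldr_closed)

lemma (in monoid) ordered_prod_cong:
  assumes "finite A" "\<And>i. i \<in> A \<Longrightarrow> f i = g i"
  shows "ordered_prod G f A = ordered_prod G g A"
  unfolding ordered_prod_def by (rule foldr_cong) (use assms in auto)

lemma (in monoid) foldr_insort:
  assumes "f i \<in> carrier G" "\<And>j. j \<in> set js \<Longrightarrow> f j \<in> carrier G"
    and "\<And>j. j \<in> set js \<Longrightarrow> f i \<otimes> f j = f j \<otimes> f i"
  shows "foldr (\<lambda>i y. f i \<otimes> y) (insort i js) \<one> = f i \<otimes> foldr (\<lambda>i y. f i \<otimes> y) js \<one>"
  using assms
proof (induction js)
  case (Cons j js)
  have "foldr (\<lambda>i y. f i \<otimes> y) js \<one> \<in> carrier G"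
    using Cons.prems by (intro foldr_closed) auto
  moreover have "f i \<otimes> f j = f j \<otimes> f i" "f i \<in> carrier G" "f j \<in> carrier G"
    using Cons.prems by auto
  ultimately show ?case
    using Cons by (simp flip: m_assoc)
qed auto

text \<open>
  Because the factors commute, the increasing order in which they are multiplied is immaterial,
  and any chosen factor can be moved to the front.
\<close>

lemma (in monoid) ordered_prod_insert:
  assumes "finite A" "i \<notin> A" "f i \<in> carrier G" "\<And>j. j \<in> A \<Longrightarrow> f j \<in> carrier G"
    and "\<And>j. j \<in> A \<Longrightarrow> f i \<otimes> f j = f j \<otimes> f i"
  shows "ordered_prod G f (insert i A) = f i \<otimes> ordered_prod G f A"
  using assms by (simp add: ordered_prod_def) (rule foldr_insort, auto)

lemma (in monoid) ordered_prod_commute: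
  assumes "finite A" "r \<in> carrier G" "\<And>j. j \<in> A \<Longrightarrow> f j \<in> carrier G"
    and "\<And>j. j \<in> A \<Longrightarrow> r \<otimes> f j = f j \<otimes> r"
  shows "r \<otimes> ordered_prod G f A = ordered_prod G f A \<otimes> r"
proof -
  have "r \<otimes> foldr (\<lambda>i y. f i \<otimes> y) js \<one> = foldr (\<lambda>i y. f i \<otimes> y) js \<one> \<otimes> r"
    if "set js \<subseteq> A" for js
    using that
  proof (induction js)
    case (Cons j js)
    have "foldr (\<lambda>i y. f i \<otimes> y) js \<one> \<in> carrier G"
      using Cons.prems assms by (intro foldr_closed) auto
    with Cons assms show ?case
      by simp (metis m_assoc)
  qed (use assms in auto)
  then show ?thesis
    using assms(1) by (simp add: ordered_prod_def)
qed

lemma (in monoid) ordered_prod_Un: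
  assumes "finite A" "finite B" "A \<inter> B = {}" "\<And>j. j \<in> A \<union> B \<Longrightarrow> f j \<in> carrier G"
    and "\<And>i j. i \<in> A \<union> B \<Longrightarrow> j \<in> A \<union> B \<Longrightarrow> f i \<otimes> f j = f j \<otimes> f i"
  shows "ordered_prod G f (A \<union> B) = ordered_prod G f A \<otimes> ordered_prod G f B"
  using assms
proof (induction A rule: finite_induct)
  case empty
  then show ?case by (simp add: ordered_prod_closed)
next
  case (insert i A)
  have 1: "ordered_prod G f (insert i A \<union> B) = f i \<otimes> ordered_prod G f (A \<union> B)"
    using insert.prems insert.hyps by simp (subst ordered_prod_insert, auto)
  have 2: "ordered_prod G f (insert i A) = f i \<otimes> ordered_prod G f A"
    using insert.prems insert.hyps by (intro ordered_prod_insert) auto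
  have "ordered_prod G f A \<in> carrier G" "ordered_prod G f B \<in> carrier G"
    using insert.prems insert.hyps by (auto intro!: ordered_prod_closed)
  with insert 1 2 show ?case by (simp add: m_assoc)
qed

section \<open>Linear combinations over the two-element field\<close>

text \<open>
  Membership in an additively closed set is how finite sums are handled below: it replaces explicit
  manipulation of coefficients in all the spanning arguments.
\<close>

lemma (in abelian_monoid) finsum_in_additive_subset:
  assumes "M \<subseteq> carrier G" "\<zero> \<in> M" "\<And>u v. u \<in> M \<Longrightarrow> v \<in> M \<Longrightarrow> u \<oplus> v \<in> M"
    and "\<And>i. i \<in> A \<Longrightarrow> f i \<in> M"
  shows "finsum G f A \<in> M"
proof (cases "finite A")
  case True
  then show ?thesis using assms(4)
  proof (induction A rule: finite_induct)
    case (insert i A)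
    then have "finsum G f (insert i A) = f i \<oplus> finsum G f A"
      using assms(1) by (intro finsum_insert) auto
    with insert assms(3) show ?case by auto
  qed (use assms in auto)
qed (use assms in \<open>simp add: finsum_infinite\<close>)

locale char_two_ring = ring R for R (structure) +
  fixes N :: "nat set"
  assumes finite_N: "finite N"
    and char2: "r \<in> carrier R \<Longrightarrow> r \<oplus> r = \<zero>"
begin

lemma bit_scale_closed [simp]: "v \<in> carrier R \<Longrightarrow> bit_scale R c v \<in> carrier R"
  by (simp add: bit_scale_def)

lemma bit_scale_add:
  "v \<in> carrier R \<Longrightarrow> bit_scale R (c + d) v = bit_scale R c v \<oplus> bit_scale R d v"
  by (cases c; cases d) (simp_all add: bit_scale_def char2)

definition lin_comb :: "(nat set \<Rightarrow> nat set \<Rightarrow> 'a) \<Rightarrow> (nat set \<times> nat set \<Rightarrow> bit) \<Rightarrow> 'a"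
  where "lin_comb B F =
    (\<Oplus>a \<in> Pow N. \<Oplus>b \<in> Pow N. bit_scale R (F (a, b)) (B a b))"

context
  fixes B :: "nat set \<Rightarrow> nat set \<Rightarrow> 'a"
  assumes B_closed: "\<And>a b. a \<subseteq> N \<Longrightarrow> b \<subseteq> N \<Longrightarrow> B a b \<in> carrier R"
begin

lemma lin_comb_closed: "lin_comb B F \<in> carrier R"
  unfolding lin_comb_def using B_closed by (auto intro!: finsum_closed)

lemma lin_comb_add: "lin_comb B F \<oplus> lin_comb B G = lin_comb B (\<lambda>p. F p + G p)"
proof -
  have inner: "(\<Oplus>b \<in> Pow N. bit_scale R (F (a, b) + G (a, b)) (B a b))
    = (\<Oplus>b \<in> Pow N. bit_scale R (F (a, b)) (B a b)) \<oplus>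
      (\<Oplus>b \<in> Pow N. bit_scale R (G (a, b)) (B a b))" if "a \<in> Pow N" for a
  proof -
    have "(\<Oplus>b \<in> Pow N. bit_scale R (F (a, b) + G (a, b)) (B a b))
      = (\<Oplus>b \<in> Pow N. bit_scale R (F (a, b)) (B a b) \<oplus> bit_scale R (G (a, b)) (B a b))"
      using that B_closed by (intro finsum_cong') (auto simp: bit_scale_add)
    also have "\<dots> = (\<Oplus>b \<in> Pow N. bit_scale R (F (a, b)) (B a b)) \<oplus>
      (\<Oplus>b \<in> Pow N. bit_scale R (G (a, b)) (B a b))"
      using that B_closed by (intro finsum_addf) auto
    finally show ?thesis .
  qed
  have closed: "(\<Oplus>b \<in> Pow N. bit_scale R (H (a, b)) (B a b)) \<in> carrier R"
    if "a \<in> Pow N" for H a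
    using that B_closed by (intro finsum_closed) auto
  have "lin_comb B (\<lambda>p. F p + G p) = (\<Oplus>a \<in> Pow N.
      (\<Oplus>b \<in> Pow N. bit_scale R (F (a, b)) (B a b)) \<oplus>
      (\<Oplus>b \<in> Pow N. bit_scale R (G (a, b)) (B a b)))"
    unfolding lin_comb_def
    by (intro finsum_cong' refl inner) (use closed in blast)+
  also have "\<dots> = lin_comb B F \<oplus> lin_comb B G"
    unfolding lin_comb_def by (intro finsum_addf) (use closed in blast)+
  finally show ?thesis by (rule sym)
qed

lemma lin_comb_single:
  assumes "a \<subseteq> N" "b \<subseteq> N"
  shows "lin_comb B (\<lambda>p. of_bool (p = (a, b))) = B a b"
proof -
  have inner: "(\<Oplus>b' \<in> Pow N. bit_scale R (of_bool ((a', b') = (a, b))) (B a' b'))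
      = (if a = a' then B a' b else \<zero>)" if "a' \<subseteq> N" for a'
  proof -
    have "(\<Oplus>b' \<in> Pow N. bit_scale R (of_bool ((a', b') = (a, b))) (B a' b'))
      = (\<Oplus>b' \<in> Pow N. if b = b' then (if a = a' then B a' b' else \<zero>) else \<zero>)"
      using B_closed that by (intro finsum_cong') (auto simp: bit_scale_def)
    also have "\<dots> = (if a = a' then B a' b else \<zero>)"
      using B_closed that assms
      by (subst finsum_singleton) (auto simp: finite_N)
    finally show ?thesis .
  qed
  have "lin_comb B (\<lambda>p. of_bool (p = (a, b)))
      = (\<Oplus>a' \<in> Pow N. if a = a' then B a' b else \<zero>)"
    unfolding lin_comb_def using B_closed assms
    by (intro finsum_cong') (auto simp only: inner PowD, auto)
  also have "\<dots> = B a b"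
    using B_closed assms by (subst finsum_singleton) (auto simp: finite_N)
  finally show ?thesis .
qed

lemma lin_comb_in_additive_subset:
  assumes "M \<subseteq> carrier R" "\<zero> \<in> M" "\<And>u v. u \<in> M \<Longrightarrow> v \<in> M \<Longrightarrow> u \<oplus> v \<in> M"
    and "\<And>a b. a \<subseteq> N \<Longrightarrow> b \<subseteq> N \<Longrightarrow> B a b \<in> M"
  shows "lin_comb B F \<in> M"
  unfolding lin_comb_def
  using assms by (intro finsum_in_additive_subset[of M]) (auto simp: bit_scale_def)

lemma zero_in_span: "\<zero> \<in> range (lin_comb B)"
proof -
  have "\<zero> = lin_comb B (\<lambda>_. 0) \<oplus> lin_comb B (\<lambda>_. 0)"
    by (simp add: char2 lin_comb_closed)
  also have "\<dots> \<in> range (lin_comb B)"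
    unfolding lin_comb_add by (rule rangeI)
  finally show ?thesis .
qed

lemma add_in_span:
  "u \<in> range (lin_comb B) \<Longrightarrow> v \<in> range (lin_comb B) \<Longrightarrow> u \<oplus> v \<in> range (lin_comb B)"
  by (elim rangeE) (simp only: lin_comb_add rangeI)

lemma basis_in_span: "a \<subseteq> N \<Longrightarrow> b \<subseteq> N \<Longrightarrow> B a b \<in> range (lin_comb B)"
  by (subst lin_comb_single[symmetric]) (assumption, assumption, rule rangeI)

text \<open>
  The vectors that left multiplication by \<open>y\<close> sends into the span form an additive subset, so it is
  enough to test \<open>y\<close> on the spanning family.
\<close>

lemma left_mult_span:
  assumes "y \<in> carrier R"
    and "\<And>a b. a \<subseteq> N \<Longrightarrow> b \<subseteq> N \<Longrightarrow> y \<otimes> B a b \<in> range (lin_comb B)"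
    and "v \<in> range (lin_comb B)"
  shows "y \<otimes> v \<in> range (lin_comb B)"
proof -
  obtain F where v: "v = lin_comb B F" using assms(3) by auto
  let ?M = "{v \<in> carrier R. y \<otimes> v \<in> range (lin_comb B)}"
  have "lin_comb B F \<in> ?M"
  proof (rule lin_comb_in_additive_subset)
    show "\<zero> \<in> ?M"
      using assms(1) zero_in_span by simp
    show "u \<oplus> w \<in> ?M" if "u \<in> ?M" "w \<in> ?M" for u w
      using that assms(1) add_in_span by (simp add: r_distr del: image_iff)
    show "B a b \<in> ?M" if "a \<subseteq> N" "b \<subseteq> N" for a b
      using that assms(2) B_closed by simp
  qed auto
  with v show ?thesis by simp
qed

end

end

section \<open>Spanning sets of the shifted Boole-Weyl algebra\<close>

text \<open>
  The defining relations, in the form of equations, over an arbitrary finite index set. The last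
  axiom says that the generators generate: starting from \<open>\<zero>\<close> and \<open>\<one>\<close>, addition and left multiplication by
  generators reach every element. Hence a span that contains \<open>\<one>\<close> and is stable under left
  multiplication by the generators is the whole ring.
\<close>

locale shifted_boole_weyl = char_two_ring +
  fixes x s :: "nat \<Rightarrow> 'a"
  assumes x_closed [simp]: "i \<in> N \<Longrightarrow> x i \<in> carrier R"
    and s_closed [simp]: "i \<in> N \<Longrightarrow> s i \<in> carrier R"
    and x_idem: "i \<in> N \<Longrightarrow> x i \<otimes> x i = x i"
    and s_invol: "i \<in> N \<Longrightarrow> s i \<otimes> s i = \<one>"
    and s_x: "i \<in> N \<Longrightarrow> s i \<otimes> x i = x i \<otimes> s i \<oplus> s i"
    and x_commute: "i \<in> N \<Longrightarrow> j \<in> N \<Longrightarrow> x i \<otimes> x j = x j \<otimes> x i"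
    and s_commute: "i \<in> N \<Longrightarrow> j \<in> N \<Longrightarrow> s i \<otimes> s j = s j \<otimes> s i"
    and s_x_commute: "i \<in> N \<Longrightarrow> j \<in> N \<Longrightarrow> i \<noteq> j \<Longrightarrow> s i \<otimes> x j = x j \<otimes> s i"
    and generated: "\<And>M. \<one> \<in> M \<Longrightarrow> \<zero> \<in> M \<Longrightarrow> (\<And>u v. u \<in> M \<Longrightarrow> v \<in> M \<Longrightarrow> u \<oplus> v \<in> M)
      \<Longrightarrow> (\<And>i u. i \<in> N \<Longrightarrow> u \<in> M \<Longrightarrow> x i \<otimes> u \<in> M)
      \<Longrightarrow> (\<And>i u. i \<in> N \<Longrightarrow> u \<in> M \<Longrightarrow> s i \<otimes> u \<in> M) \<Longrightarrow> carrier R \<subseteq> M"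
begin

lemma finite_index: "a \<subseteq> N \<Longrightarrow> finite a"
  by (rule finite_subset[OF _ finite_N])

abbreviation "xp \<equiv> ordered_prod R x"
abbreviation "sp \<equiv> ordered_prod R s"
abbreviation "mp a \<equiv> xp a \<otimes> ordered_prod R (\<lambda>i. x i \<oplus> \<one>) (N - a)"

lemma xp_closed [simp]: "a \<subseteq> N \<Longrightarrow> xp a \<in> carrier R"
  by (rule ordered_prod_closed[OF finite_index]) auto

lemma sp_closed [simp]: "a \<subseteq> N \<Longrightarrow> sp a \<in> carrier R"
  by (rule ordered_prod_closed[OF finite_index]) auto

lemma xp_insert: "i \<in> N \<Longrightarrow> a \<subseteq> N \<Longrightarrow> i \<notin> a \<Longrightarrow> xp (insert i a) = x i \<otimes> xp a"
  by (intro ordered_prod_insert finite_index) (auto intro: x_commute)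

lemma sp_insert: "i \<in> N \<Longrightarrow> a \<subseteq> N \<Longrightarrow> i \<notin> a \<Longrightarrow> sp (insert i a) = s i \<otimes> sp a"
  by (intro ordered_prod_insert finite_index) (auto intro: s_commute)

lemma x_xp:
  assumes "i \<in> N" "a \<subseteq> N"
  shows "x i \<otimes> xp a = xp (insert i a)"
proof (cases "i \<in> a")
  case True
  then have a: "xp a = x i \<otimes> xp (a - {i})"
    using xp_insert[of i "a - {i}"] assms by (auto simp: insert_absorb)
  have "a - {i} \<subseteq> N" using assms by auto
  with assms True show ?thesis
    by (simp add: a insert_absorb x_idem flip: m_assoc)
qed (use assms xp_insert in simp)

lemma s_sp:
  assumes "i \<in> N" "b \<subseteq> N"
  shows "s i \<otimes> sp b = sp (sym_diff b {i})"
proof (cases "i \<in> b")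
  case True
  then have b: "sp b = s i \<otimes> sp (b - {i})"
    using sp_insert[of i "b - {i}"] assms by (auto simp: insert_absorb)
  have sub: "b - {i} \<subseteq> N" using assms by auto
  have "sym_diff b {i} = b - {i}" using True by auto
  with assms sub show ?thesis
    by (simp add: b s_invol flip: m_assoc)
next
  case False
  then have "sym_diff b {i} = insert i b" by auto
  with False assms sp_insert show ?thesis by simp
qed

lemma s_xp_commute:
  assumes "i \<in> N" "a \<subseteq> N" "i \<notin> a"
  shows "s i \<otimes> xp a = xp a \<otimes> s i"
  using assms by (intro ordered_prod_commute finite_index) (auto intro: s_x_commute)

text \<open>
  The shift turns the factor \<open>x i\<close> into \<open>x i + 1\<close>; expanding it gives a term with the factor and a
  term without.
\<close>

lemma s_xp:
  assumes "i \<in> N" "a \<subseteq> N" "i \<in> a"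
  shows "s i \<otimes> xp a = (xp a \<oplus> xp (a - {i})) \<otimes> s i"
proof -
  have sub: "a - {i} \<subseteq> N" using assms by auto
  have a: "xp a = x i \<otimes> xp (a - {i})"
    using xp_insert[of i "a - {i}"] assms by (auto simp: insert_absorb)
  have c: "s i \<otimes> xp (a - {i}) = xp (a - {i}) \<otimes> s i"
    using assms sub by (intro s_xp_commute) auto
  have "s i \<otimes> xp a = (x i \<otimes> s i \<oplus> s i) \<otimes> xp (a - {i})"
    using assms sub by (simp add: a s_x flip: m_assoc)
  also have "\<dots> = (xp a \<oplus> xp (a - {i})) \<otimes> s i"
    using assms sub c by (simp add: a l_distr m_assoc)
  finally show ?thesis .
qed

lemma xs_span: "carrier R \<subseteq> range (lin_comb (\<lambda>a b. xp a \<otimes> sp b))"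
proof -
  let ?B = "\<lambda>a b. xp a \<otimes> sp b"
  have cl: "?B a b \<in> carrier R" if "a \<subseteq> N" "b \<subseteq> N" for a b
    using that by simp
  note span = zero_in_span[of ?B, OF cl] add_in_span[of ?B, OF cl] basis_in_span[of ?B, OF cl]
  show ?thesis
  proof (rule generated)
    show "\<one> \<in> range (lin_comb ?B)" using span(3)[of "{}" "{}"] by simp
    show "x i \<otimes> u \<in> range (lin_comb ?B)" if "i \<in> N" "u \<in> range (lin_comb ?B)" for i u
    proof (rule left_mult_span[of ?B, OF cl _ _ that(2)])
      fix a b assume ab: "a \<subseteq> N" "b \<subseteq> N"
      then have "x i \<otimes> ?B a b = ?B (insert i a) b"
        using that by (simp add: x_xp flip: m_assoc)
      then show "x i \<otimes> ?B a b \<in> range (lin_comb ?B)"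
        using span(3)[of "insert i a" b] ab that by simp
    qed (use that in auto)
    show "s i \<otimes> u \<in> range (lin_comb ?B)" if "i \<in> N" "u \<in> range (lin_comb ?B)" for i u
    proof (rule left_mult_span[of ?B, OF cl _ _ that(2)])
      fix a b assume ab: "a \<subseteq> N" "b \<subseteq> N"
      define b' where "b' = sym_diff b {i}"
      have b': "b' \<subseteq> N" "s i \<otimes> sp b = sp b'"
        using ab that by (auto simp: b'_def s_sp)
      show "s i \<otimes> ?B a b \<in> range (lin_comb ?B)"
      proof (cases "i \<in> a")
        case True
        have sub: "a - {i} \<subseteq> N" using ab by auto
        have "s i \<otimes> ?B a b = (s i \<otimes> xp a) \<otimes> sp b"
          using ab that by (simp add: m_assoc)
        also have "\<dots> = ?B a b' \<oplus> ?B (a - {i}) b'"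
          using ab that sub True by (simp add: s_xp m_assoc b' l_distr)
        finally show ?thesis
          using span(2,3) ab b' sub by simp
      next
        case False
        have "s i \<otimes> ?B a b = (s i \<otimes> xp a) \<otimes> sp b"
          using ab that by (simp add: m_assoc)
        also have "\<dots> = ?B a b'"
          using ab that False by (simp add: s_xp_commute m_assoc b')
        finally show ?thesis
          using span(3) ab b' by simp
      qed
    qed (use that in auto)
  qed (use span in auto)
qed

text \<open>
  Each minterm is one ordered product over the whole index set, of literals \<open>x i\<close> or \<open>x i + 1\<close>. In
  this form any index can be split off without distinguishing whether it lies in \<open>a\<close>.
\<close>

definition literal :: "nat set \<Rightarrow> nat \<Rightarrow> 'a"
  where "literal a i = (if i \<in> a then x i else x i \<oplus> \<one>)"

abbreviation "lp a \<equiv> ordered_prod R (literal a)"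

lemma literal_closed [simp]: "i \<in> N \<Longrightarrow> literal a i \<in> carrier R"
  by (simp add: literal_def)

lemma lp_closed [simp]: "A \<subseteq> N \<Longrightarrow> lp a A \<in> carrier R"
  by (rule ordered_prod_closed[OF finite_index]) auto

lemma x_literal_commute:
  "i \<in> N \<Longrightarrow> j \<in> N \<Longrightarrow> x i \<otimes> literal a j = literal a j \<otimes> x i"
  by (simp add: literal_def x_commute l_distr r_distr)

lemma literal_commute:
  "i \<in> N \<Longrightarrow> j \<in> N \<Longrightarrow> literal a i \<otimes> literal a j = literal a j \<otimes> literal a i"
  by (subst (1 4) literal_def) (simp add: x_literal_commute l_distr r_distr)

lemma lp_insert:
  "i \<in> N \<Longrightarrow> A \<subseteq> N \<Longrightarrow> i \<notin> A \<Longrightarrow> lp a (insert i A) = literal a i \<otimes> lp a A"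
  by (intro ordered_prod_insert finite_index) (auto intro: literal_commute)

lemma lp_cong: "A \<subseteq> N \<Longrightarrow> a \<inter> A = a' \<inter> A \<Longrightarrow> lp a A = lp a' A"
  by (intro ordered_prod_cong finite_index) (auto simp: literal_def)

lemma mp_eq_lp:
  assumes "a \<subseteq> N"
  shows "mp a = lp a N"
proof -
  have "lp a (a \<union> (N - a)) = lp a a \<otimes> lp a (N - a)"
    using assms by (intro ordered_prod_Un finite_index) (auto intro: literal_commute)
  moreover have "lp a a = xp a"
    using assms by (intro ordered_prod_cong finite_index) (auto simp: literal_def)
  moreover have "lp a (N - a) = ordered_prod R (\<lambda>i. x i \<oplus> \<one>) (N - a)"
    by (intro ordered_prod_cong) (auto simp: literal_def finite_N)
  moreover have "a \<union> (N - a) = N" using assms by auto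
  ultimately show ?thesis by simp
qed

lemma x_literal: "i \<in> N \<Longrightarrow> x i \<otimes> literal a i = (if i \<in> a then literal a i else \<zero>)"
  by (simp add: literal_def r_distr x_idem char2)

text \<open>
  The shift exchanges the two literals of its own index, since \<open>s i (x i + 1) = x i s i\<close> as well.
\<close>

lemma s_literal:
  assumes "i \<in> N"
  shows "s i \<otimes> literal a i = literal (sym_diff a {i}) i \<otimes> s i"
proof -
  have "s i \<otimes> (x i \<oplus> \<one>) = (x i \<otimes> s i \<oplus> s i) \<oplus> s i"
    using assms by (simp add: r_distr s_x)
  also have "\<dots> = x i \<otimes> s i"
    using assms by (simp add: a_assoc char2)
  finally show ?thesis
    using assms by (auto simp: literal_def s_x l_distr)
qed

lemma lp_split:
  assumes "i \<in> N"
  shows "lp a N = literal a i \<otimes> lp a (N - {i})"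
  using lp_insert[of i "N - {i}" a] assms by (auto simp: insert_absorb)

lemma x_lp:
  assumes "i \<in> N"
  shows "x i \<otimes> lp a N = (if i \<in> a then lp a N else \<zero>)"
proof -
  have "N - {i} \<subseteq> N" by auto
  then show ?thesis
    using assms by (simp add: lp_split[OF assms] x_literal flip: m_assoc)
qed

lemma s_lp:
  assumes "i \<in> N"
  shows "s i \<otimes> lp a N = lp (sym_diff a {i}) N \<otimes> s i"
proof -
  let ?A = "N - {i}"
  have sub: "?A \<subseteq> N" by auto
  have "s i \<otimes> lp a ?A = lp a ?A \<otimes> s i"
    using assms
    by (intro ordered_prod_commute finite_index)
      (auto simp: literal_def r_distr l_distr s_x_commute)
  moreover have "lp a ?A = lp (sym_diff a {i}) ?A"
    by (intro lp_cong) auto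
  ultimately show ?thesis
    using assms sub
    by (simp add: lp_split[OF assms] s_literal m_assoc flip: m_assoc[of "s i"])
qed

text \<open>
  Multiplying by \<open>1 = x i + (x i + 1)\<close> one index at a time writes the empty product as a sum of
  full products of literals.
\<close>

lemma lp_in_additive_subset:
  assumes "M \<subseteq> carrier R" "\<And>u v. u \<in> M \<Longrightarrow> v \<in> M \<Longrightarrow> u \<oplus> v \<in> M"
    and "\<And>a. a \<subseteq> N \<Longrightarrow> lp a N \<in> M"
    and "C \<subseteq> N" "a \<subseteq> N"
  shows "lp a (N - C) \<in> M"
proof -
  have "finite C" using assms(4) by (rule finite_index)
  then show ?thesis using assms(4,5)
  proof (induction C arbitrary: a rule: finite_induct)
    case (insert i C)
    let ?A = "N - insert i C"
    have i: "i \<in> N" "i \<notin> ?A" "?A \<subseteq> N" "insert i ?A = N - C"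
      using insert by auto
    have sub: "insert i a \<subseteq> N" "a - {i} \<subseteq> N"
      using insert.prems by auto
    have l: "lp a ?A = lp (insert i a) ?A" "lp a ?A = lp (a - {i}) ?A"
      by (intro lp_cong; auto)+
    have "lp (insert i a) (N - C) \<oplus> lp (a - {i}) (N - C)
       = literal (insert i a) i \<otimes> lp a ?A \<oplus> literal (a - {i}) i \<otimes> lp a ?A"
      using lp_insert[OF i(1,3,2)] i(4) l by simp
    also have "\<dots> = (x i \<oplus> (x i \<oplus> \<one>)) \<otimes> lp a ?A"
      using i by (simp add: literal_def l_distr)
    also have "\<dots> = lp a ?A"
      using i by (simp add: char2 flip: a_assoc)
    finally have "lp a ?A = lp (insert i a) (N - C) \<oplus> lp (a - {i}) (N - C)" by simp
    moreover have "lp (insert i a) (N - C) \<in> M" "lp (a - {i}) (N - C) \<in> M"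
      using insert sub by auto
    ultimately show ?case using assms(2) by simp
  qed (use assms in auto)
qed

lemma ms_span: "carrier R \<subseteq> range (lin_comb (\<lambda>a b. mp a \<otimes> sp b))"
proof -
  let ?B = "\<lambda>a b. mp a \<otimes> sp b"
  have cl: "?B a b \<in> carrier R" if "a \<subseteq> N" "b \<subseteq> N" for a b
    using that mp_eq_lp by simp
  note span = zero_in_span[of ?B, OF cl] add_in_span[of ?B, OF cl] basis_in_span[of ?B, OF cl]
  show ?thesis
  proof (rule generated)
    have "lp {} (N - N) \<in> {v \<in> carrier R. v \<in> range (lin_comb ?B)}"
    proof (rule lp_in_additive_subset)
      show "lp a N \<in> {v \<in> carrier R. v \<in> range (lin_comb ?B)}" if "a \<subseteq> N" for a
        using span(3)[of a "{}"] that by (simp add: mp_eq_lp)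
    qed (use span(2) in auto)
    then show "\<one> \<in> range (lin_comb ?B)" by simp
    show "x i \<otimes> u \<in> range (lin_comb ?B)" if "i \<in> N" "u \<in> range (lin_comb ?B)" for i u
    proof (rule left_mult_span[of ?B, OF cl _ _ that(2)])
      fix a b assume ab: "a \<subseteq> N" "b \<subseteq> N"
      then have "x i \<otimes> ?B a b = (if i \<in> a then ?B a b else \<zero>)"
        using that by (simp add: mp_eq_lp x_lp flip: m_assoc)
      then show "x i \<otimes> ?B a b \<in> range (lin_comb ?B)"
        using span(1) span(3)[of a b] ab by simp
    qed (use that in auto)
    show "s i \<otimes> u \<in> range (lin_comb ?B)" if "i \<in> N" "u \<in> range (lin_comb ?B)" for i u
    proof (rule left_mult_span[of ?B, OF cl _ _ that(2)])
      fix a b assume ab: "a \<subseteq> N" "b \<subseteq> N"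
      define a' b' where "a' = sym_diff a {i}" and "b' = sym_diff b {i}"
      have sub: "a' \<subseteq> N" "b' \<subseteq> N" using ab that by (auto simp: a'_def b'_def)
      have "s i \<otimes> ?B a b = (s i \<otimes> lp a N) \<otimes> sp b"
        using ab that by (simp add: m_assoc mp_eq_lp)
      also have "\<dots> = lp a' N \<otimes> s i \<otimes> sp b"
        using that by (simp add: s_lp a'_def)
      also have "\<dots> = ?B a' b'"
        using ab that sub by (simp add: m_assoc mp_eq_lp s_sp b'_def)
      finally show "s i \<otimes> ?B a b \<in> range (lin_comb ?B)"
        using span(3)[of a' b'] sub by simp
    qed (use that in auto)
  qed (use span in auto)
qed

end

section \<open>The action on functions\<close>

text \<open>
  The functions are defined on all sets of natural numbers, so that one action serves every \<open>n\<close>; the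
  coordinates are later read off at subsets of \<open>{1..n}\<close>.
\<close>

fun gen_act :: "gen \<Rightarrow> (nat set \<Rightarrow> bit) \<Rightarrow> nat set \<Rightarrow> bit"
  where
    "gen_act (GX i) \<phi> u = of_bool (i \<in> u) * \<phi> u"
  | "gen_act (GS i) \<phi> u = \<phi> (sym_diff u {i})"

definition word_act :: "gen word \<Rightarrow> (nat set \<Rightarrow> bit) \<Rightarrow> nat set \<Rightarrow> bit"
  where "word_act w = foldr gen_act (letters w)"

definition act :: "(gen word \<Rightarrow>\<^sub>0 bit) \<Rightarrow> (nat set \<Rightarrow> bit) \<Rightarrow> nat set \<Rightarrow> bit"
  where "act p \<phi> u = (\<Sum>w\<in>Poly_Mapping.keys p. Poly_Mapping.lookup p w * word_act w \<phi> u)"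

lemma word_act_plus: "word_act (v + w) \<phi> = word_act v (word_act w \<phi>)"
  by (simp add: word_act_def plus_word_def)

lemma word_act_zero [simp]: "word_act 0 \<phi> = \<phi>"
  by (simp add: word_act_def zero_word_def)

lemma word_act_add: "word_act w (\<lambda>u. \<phi> u + \<psi> u) = (\<lambda>u. word_act w \<phi> u + word_act w \<psi> u)"
proof -
  have gen: "gen_act g (\<lambda>u. \<phi> u + \<psi> u) = (\<lambda>u. gen_act g \<phi> u + gen_act g \<psi> u)" for g \<phi> \<psi>
    by (cases g) (auto simp: fun_eq_iff distrib_left)
  have "foldr gen_act gs (\<lambda>u. \<phi> u + \<psi> u) = (\<lambda>u. foldr gen_act gs \<phi> u + foldr gen_act gs \<psi> u)" for gs
    by (induction gs) (simp_all add: gen)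
  then show ?thesis by (simp add: word_act_def)
qed

lemma word_act_null: "word_act w (\<lambda>_. 0) = (\<lambda>_. 0)"
proof -
  have gen: "gen_act g (\<lambda>_. 0) = (\<lambda>_. 0)" for g
    by (cases g) (auto simp: fun_eq_iff)
  have "foldr gen_act gs (\<lambda>_. 0) = (\<lambda>_. 0)" for gs
    by (induction gs) (simp_all add: gen)
  then show ?thesis by (simp add: word_act_def)
qed

lemma act_zero [simp]: "act 0 \<phi> u = 0"
  by (simp add: act_def)

lemma act_add: "act (p + q) \<phi> u = act p \<phi> u + act q \<phi> u"
  unfolding act_def by (rule setsum_keys_plus_distrib) (simp_all add: distrib_right)

lemma act_single: "act (Poly_Mapping.single w c) \<phi> u = c * word_act w \<phi> u"
  by (simp add: act_def)

lemma act_null: "act p (\<lambda>_. 0) = (\<lambda>_. 0)"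
  by (simp add: act_def fun_eq_iff word_act_null)

text \<open>
  Over the two-element field every nonzero coefficient is \<open>1\<close>, so an element of the monoid algebra
  is built by adding one word at a time.
\<close>

lemma bit_poly_induct [case_names zero add]:
  fixes p :: "'a \<Rightarrow>\<^sub>0 bit"
  assumes "P 0"
    and "\<And>w p. w \<notin> Poly_Mapping.keys p \<Longrightarrow> P p \<Longrightarrow> P (Poly_Mapping.single w 1 + p)"
  shows "P p"
proof (induction p rule: update_induct)
  case (update p w c)
  have "Poly_Mapping.update w c p = Poly_Mapping.single w 1 + p"
    using update by (intro poly_mapping_eqI)
      (auto simp: lookup_update lookup_add lookup_single when_def in_keys_iff)
  with assms(2) update show ?case by simp
qed (rule assms)

lemma keys_single_add:
  fixes p :: "'a \<Rightarrow>\<^sub>0 bit"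
  assumes "w \<notin> Poly_Mapping.keys p"
  shows "Poly_Mapping.keys (Poly_Mapping.single w 1 + p) = insert w (Poly_Mapping.keys p)"
  using assms by (auto simp: in_keys_iff lookup_add lookup_single when_def split: if_splits)

lemma act_single_mult:
  "act (Poly_Mapping.single v c * q) \<phi> u = c * word_act v (act q \<phi>) u"
proof (induction q rule: bit_poly_induct)
  case zero
  then show ?case by (simp add: act_null word_act_null act_def)
next
  case (add w q)
  have "act (Poly_Mapping.single w 1 + q) \<phi> = (\<lambda>u. word_act w \<phi> u + act q \<phi> u)"
    by (simp add: fun_eq_iff act_add act_single)
  then show ?case
    using add by (simp add: distrib_left act_add mult_single act_single word_act_plus word_act_add)
qed

lemma act_mult: "act (p * q) \<phi> = act p (act q \<phi>)"
proof (rule ext)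
  show "act (p * q) \<phi> u = act p (act q \<phi>) u" for u
    by (induction p rule: bit_poly_induct)
      (simp_all add: distrib_right act_add act_single_mult act_single)
qed

lemma act_one [simp]: "act 1 \<phi> = \<phi>"
  by (simp add: fun_eq_iff act_single flip: single_one)

lemma act_x: "act (free_x i) \<phi> u = of_bool (i \<in> u) * \<phi> u"
  by (simp add: free_x_def act_single word_act_def)

lemma act_s: "act (free_s i) \<phi> u = \<phi> (sym_diff u {i})"
  by (simp add: free_s_def act_single word_act_def)

section \<open>The presentation\<close>

lemma free_alg_simps [simp]:
  "(\<otimes>\<^bsub>free_alg n\<^esub>) = (*)" "\<one>\<^bsub>free_alg n\<^esub> = 1"
  "\<zero>\<^bsub>free_alg n\<^esub> = 0" "(\<oplus>\<^bsub>free_alg n\<^esub>) = (+)"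
  by (simp_all add: free_alg_def)

lemma free_alg_carrier:
  "p \<in> carrier (free_alg n) \<longleftrightarrow> (\<forall>w \<in> Poly_Mapping.keys p. set (letters w) \<subseteq> gens n)"
  by (simp add: free_alg_def)

lemma free_alg_zero_closed: "0 \<in> carrier (free_alg n)"
  and free_alg_one_closed: "1 \<in> carrier (free_alg n)"
  and free_x_closed: "i \<in> {1..n} \<Longrightarrow> free_x i \<in> carrier (free_alg n)"
  and free_s_closed: "i \<in> {1..n} \<Longrightarrow> free_s i \<in> carrier (free_alg n)"
  by (auto simp: free_alg_carrier zero_word_def gens_def free_x_def free_s_def)

lemma free_alg_add_closed:
  "p \<in> carrier (free_alg n) \<Longrightarrow> q \<in> carrier (free_alg n) \<Longrightarrow> p + q \<in> carrier (free_alg n)"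
  using keys_add[of p q] by (auto simp: free_alg_carrier)

lemma free_alg_mult_closed:
  assumes "p \<in> carrier (free_alg n)" "q \<in> carrier (free_alg n)"
  shows "p * q \<in> carrier (free_alg n)"
  unfolding free_alg_carrier
proof
  fix w assume "w \<in> Poly_Mapping.keys (p * q)"
  then obtain u v where "u \<in> Poly_Mapping.keys p" "v \<in> Poly_Mapping.keys q" "w = u + v"
    using keys_mult[of p q] by auto
  with assms show "set (letters w) \<subseteq> gens n"
    by (simp add: free_alg_carrier plus_word_def)
qed

lemma bit_poly_add_self: "p + p = 0" for p :: "'a \<Rightarrow>\<^sub>0 bit"
proof (rule poly_mapping_eqI)
  show "Poly_Mapping.lookup (p + p) w = Poly_Mapping.lookup 0 w" for w
    by (cases "Poly_Mapping.lookup p w") (simp_all add: lookup_add)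
qed

lemma free_alg_ring: "ring (free_alg n)"
proof (rule ringI)
  show "abelian_group (free_alg n)"
  proof (rule abelian_groupI)
    show "\<exists>q\<in>carrier (free_alg n). q \<oplus>\<^bsub>free_alg n\<^esub> p = \<zero>\<^bsub>free_alg n\<^esub>"
      if "p \<in> carrier (free_alg n)" for p
      using that bit_poly_add_self[of p] by auto
  qed (auto simp: free_alg_add_closed free_alg_zero_closed add_ac)
  show "Group.monoid (free_alg n)"
    by (rule monoidI) (auto simp: free_alg_mult_closed free_alg_one_closed mult.assoc)
qed (auto simp: distrib_left distrib_right)

text \<open>
  A word is built by putting letters in front, so a set that contains \<open>1\<close> and is closed under
  addition and under left multiplication by the generators is everything.
\<close>

lemma free_alg_generated:
  assumes "1 \<in> M" "0 \<in> M" "\<And>p q. p \<in> M \<Longrightarrow> q \<in> M \<Longrightarrow> p + q \<in> M"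
    and "\<And>i p. i \<in> {1..n} \<Longrightarrow> p \<in> M \<Longrightarrow> free_x i * p \<in> M"
    and "\<And>i p. i \<in> {1..n} \<Longrightarrow> p \<in> M \<Longrightarrow> free_s i * p \<in> M"
  shows "carrier (free_alg n) \<subseteq> M"
proof -
  have word: "Poly_Mapping.single (Word gs) 1 \<in> M" if "set gs \<subseteq> gens n" for gs
    using that
  proof (induction gs)
    case Nil
    then show ?case using assms(1) by (simp flip: zero_word_def)
  next
    case (Cons g gs)
    have "Poly_Mapping.single (Word (g # gs)) 1
      = Poly_Mapping.single (Word [g]) 1 * (Poly_Mapping.single (Word gs) (1::bit))"
      by (simp add: mult_single plus_word_def)
    moreover have "(\<exists>i\<in>{1..n}. g = GX i) \<or> (\<exists>i\<in>{1..n}. g = GS i)"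
      using Cons.prems by (auto simp: gens_def)
    ultimately show ?case
      using Cons assms(4,5) by (auto simp: free_x_def free_s_def)
  qed
  have "p \<in> M" if "p \<in> carrier (free_alg n)" for p
    using that
  proof (induction p rule: bit_poly_induct)
    case zero
    then show ?case using assms(2) by simp
  next
    case (add w p)
    then have "set (letters w) \<subseteq> gens n" "p \<in> carrier (free_alg n)"
      by (auto simp: free_alg_carrier keys_single_add)
    with add.IH word[of "letters w"] assms(3) show ?case by simp
  qed
  then show ?thesis by auto
qed

text \<open>
  The elements that act trivially form an ideal containing the relations, hence containing the ideal
  of the presentation; this is what makes the action descend to the quotient.
\<close>

definition act_kernel :: "nat \<Rightarrow> (gen word \<Rightarrow>\<^sub>0 bit) set"
  where "act_kernel n = {p \<in> carrier (free_alg n). \<forall>\<phi>. act p \<phi> = (\<lambda>_. 0)}"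

lemma act_kernel_ideal: "ideal (act_kernel n) (free_alg n)"
proof (rule idealI[OF free_alg_ring])
  interpret ring "free_alg n" by (rule free_alg_ring)
  have inv: "\<ominus>\<^bsub>free_alg n\<^esub> p = p" if "p \<in> carrier (free_alg n)" for p
    using that bit_poly_add_self[of p] by (intro minus_equality) auto
  show "subgroup (act_kernel n) (add_monoid (free_alg n))"
  proof (rule group.subgroupI[OF a_group])
    show "inv\<^bsub>add_monoid (free_alg n)\<^esub> p \<in> act_kernel n" if "p \<in> act_kernel n" for p
      using that inv[of p] by (simp add: a_inv_def act_kernel_def)
    have "0 \<in> act_kernel n"
      by (simp add: act_kernel_def free_alg_zero_closed fun_eq_iff)
    then show "act_kernel n \<noteq> {}" by auto
  qed (auto simp: act_kernel_def free_alg_add_closed act_add fun_eq_iff)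
qed (auto simp: act_kernel_def free_alg_mult_closed act_mult act_null)

lemma sbw_relations_closed: "sbw_relations n \<subseteq> carrier (free_alg n)"
  by (auto simp: sbw_relations_def intro!: free_alg_add_closed free_alg_mult_closed
      free_x_closed free_s_closed free_alg_one_closed)

lemma bit_add_self [simp]: "(c::bit) + c = 0"
  by (cases c) simp_all

lemma sbw_relations_act: "sbw_relations n \<subseteq> act_kernel n"
proof -
  have "sym_diff (sym_diff u {i}) {i} = u" for u and i :: nat by auto
  moreover have "sym_diff (sym_diff u {i}) {j} = sym_diff (sym_diff u {j}) {i}" for u and i j :: nat
    by auto
  ultimately have "act p \<phi> = (\<lambda>_. 0)" if "p \<in> sbw_relations n" for p \<phi>
    using that
    by (auto simp: sbw_relations_def act_add act_mult act_x act_s fun_eq_iff)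
  then show ?thesis
    using sbw_relations_closed by (auto simp: act_kernel_def)
qed

lemma sbw_ideal_ideal: "ideal (sbw_ideal n) (free_alg n)"
  unfolding sbw_ideal_def
  by (rule ring.genideal_ideal[OF free_alg_ring sbw_relations_closed])

lemma sbw_ideal_act: "p \<in> sbw_ideal n \<Longrightarrow> act p \<phi> u = 0"
  using ring.genideal_minimal[OF free_alg_ring act_kernel_ideal sbw_relations_act]
  by (fastforce simp: sbw_ideal_def act_kernel_def)

abbreviation sbw_class :: "nat \<Rightarrow> (gen word \<Rightarrow>\<^sub>0 bit) \<Rightarrow> (gen word \<Rightarrow>\<^sub>0 bit) set"
  where "sbw_class n p \<equiv> sbw_ideal n +>\<^bsub>free_alg n\<^esub> p"

lemma sbw_class_hom: "sbw_class n \<in> ring_hom (free_alg n) (SBW n)"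
  unfolding SBW_def by (rule ideal.rcos_ring_hom[OF sbw_ideal_ideal])

lemma SBW_ring: "ring (SBW n)"
  unfolding SBW_def by (rule ideal.quotient_is_ring[OF sbw_ideal_ideal])

lemma sbw_class_zero: "sbw_class n 0 = \<zero>\<^bsub>SBW n\<^esub>"
  using ring_hom_zero[OF sbw_class_hom free_alg_ring SBW_ring] by simp

lemma sbw_class_one: "sbw_class n 1 = \<one>\<^bsub>SBW n\<^esub>"
  using ring_hom_one[OF sbw_class_hom] by simp

lemma sbw_class_add:
  "p \<in> carrier (free_alg n) \<Longrightarrow> q \<in> carrier (free_alg n)
    \<Longrightarrow> sbw_class n (p + q) = sbw_class n p \<oplus>\<^bsub>SBW n\<^esub> sbw_class n q"
  using ring_hom_add[OF sbw_class_hom] by simp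

lemma sbw_class_mult:
  "p \<in> carrier (free_alg n) \<Longrightarrow> q \<in> carrier (free_alg n)
    \<Longrightarrow> sbw_class n (p * q) = sbw_class n p \<otimes>\<^bsub>SBW n\<^esub> sbw_class n q"
  using ring_hom_mult[OF sbw_class_hom] by simp

lemma sbw_class_closed: "p \<in> carrier (free_alg n) \<Longrightarrow> sbw_class n p \<in> carrier (SBW n)"
  by (rule ring_hom_closed[OF sbw_class_hom])

lemma SBW_carrier_cases:
  assumes "f \<in> carrier (SBW n)"
  obtains p where "p \<in> carrier (free_alg n)" "f = sbw_class n p"
  using assms by (auto simp: SBW_def FactRing_def A_RCOSETS_def RCOSETS_def a_r_coset_def)

lemma SBW_char2:
  assumes "f \<in> carrier (SBW n)"
  shows "f \<oplus>\<^bsub>SBW n\<^esub> f = \<zero>\<^bsub>SBW n\<^esub>"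
  using assms
  by (elim SBW_carrier_cases) (simp add: bit_poly_add_self sbw_class_zero flip: sbw_class_add)

text \<open>
  Adding the class of \<open>q\<close> to the vanishing class of \<open>p + q\<close> cancels it, the characteristic being two.
\<close>

lemma sbw_relation_eq:
  assumes "p + q \<in> sbw_relations n" "p \<in> carrier (free_alg n)" "q \<in> carrier (free_alg n)"
  shows "sbw_class n p = sbw_class n q"
proof -
  interpret S: ring "SBW n" by (rule SBW_ring)
  interpret I: ideal "sbw_ideal n" "free_alg n" by (rule sbw_ideal_ideal)
  have "p + q \<in> sbw_ideal n"
    using assms(1) ring.genideal_self[OF free_alg_ring sbw_relations_closed]
    by (auto simp: sbw_ideal_def)
  then have "sbw_class n (p + q) = \<zero>\<^bsub>SBW n\<^esub>"
    by (simp add: I.a_rcos_const SBW_def FactRing_def)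
  then have "sbw_class n p \<oplus>\<^bsub>SBW n\<^esub> sbw_class n q = sbw_class n q \<oplus>\<^bsub>SBW n\<^esub> sbw_class n q"
    using assms by (simp add: sbw_class_add SBW_char2 sbw_class_closed)
  then show ?thesis
    using assms by (simp add: sbw_class_closed)
qed

lemma SBW_shifted_boole_weyl: "shifted_boole_weyl (SBW n) {1..n} (sbw_x n) (sbw_s n)"
proof -
  interpret S: ring "SBW n" by (rule SBW_ring)
  note closed = free_x_closed free_s_closed free_alg_one_closed
    free_alg_mult_closed free_alg_add_closed
  have rel: "\<And>i. i \<in> {1..n} \<Longrightarrow> free_x i * free_x i + free_x i \<in> sbw_relations n"
    "\<And>i. i \<in> {1..n} \<Longrightarrow> free_s i * free_s i + 1 \<in> sbw_relations n"
    "\<And>i. i \<in> {1..n} \<Longrightarrow> free_s i * free_x i + (free_x i * free_s i + free_s i) \<in> sbw_relations n"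
    "\<And>i j. i \<in> {1..n} \<Longrightarrow> j \<in> {1..n}
      \<Longrightarrow> free_x i * free_x j + free_x j * free_x i \<in> sbw_relations n"
    "\<And>i j. i \<in> {1..n} \<Longrightarrow> j \<in> {1..n}
      \<Longrightarrow> free_s i * free_s j + free_s j * free_s i \<in> sbw_relations n"
    "\<And>i j. i \<in> {1..n} \<Longrightarrow> j \<in> {1..n} \<Longrightarrow> i \<noteq> j
      \<Longrightarrow> free_s i * free_x j + free_x j * free_s i \<in> sbw_relations n"
    unfolding sbw_relations_def add.assoc by blast+
  have x: "sbw_x n i = sbw_class n (free_x i)" and s: "sbw_s n i = sbw_class n (free_s i)" for i
    by (simp_all add: sbw_x_def sbw_s_def)
  show ?thesis
  proof (unfold_locales)
    show "finite {1..n}" by simp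
    show "r \<oplus>\<^bsub>SBW n\<^esub> r = \<zero>\<^bsub>SBW n\<^esub>" if "r \<in> carrier (SBW n)" for r
      using that by (rule SBW_char2)
    fix i assume i: "i \<in> {1..n}"
    show "sbw_x n i \<in> carrier (SBW n)" "sbw_s n i \<in> carrier (SBW n)"
      unfolding x s by (intro sbw_class_closed closed i)+
    show "sbw_x n i \<otimes>\<^bsub>SBW n\<^esub> sbw_x n i = sbw_x n i"
      using sbw_relation_eq[OF rel(1)] i by (simp only: x closed flip: sbw_class_mult)
    show "sbw_s n i \<otimes>\<^bsub>SBW n\<^esub> sbw_s n i = \<one>\<^bsub>SBW n\<^esub>"
      using sbw_relation_eq[OF rel(2)] i
      by (simp only: s closed flip: sbw_class_mult sbw_class_one)
    show "sbw_s n i \<otimes>\<^bsub>SBW n\<^esub> sbw_x n i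
      = sbw_x n i \<otimes>\<^bsub>SBW n\<^esub> sbw_s n i \<oplus>\<^bsub>SBW n\<^esub> sbw_s n i"
      using sbw_relation_eq[OF rel(3)] i
      by (simp only: x s closed flip: sbw_class_mult sbw_class_add)
    fix j assume j: "j \<in> {1..n}"
    show "sbw_x n i \<otimes>\<^bsub>SBW n\<^esub> sbw_x n j = sbw_x n j \<otimes>\<^bsub>SBW n\<^esub> sbw_x n i"
      using sbw_relation_eq[OF rel(4)] i j by (simp only: x closed flip: sbw_class_mult)
    show "sbw_s n i \<otimes>\<^bsub>SBW n\<^esub> sbw_s n j = sbw_s n j \<otimes>\<^bsub>SBW n\<^esub> sbw_s n i"
      using sbw_relation_eq[OF rel(5)] i j by (simp only: s closed flip: sbw_class_mult)
    show "sbw_s n i \<otimes>\<^bsub>SBW n\<^esub> sbw_x n j = sbw_x n j \<otimes>\<^bsub>SBW n\<^esub> sbw_s n i" if "i \<noteq> j"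
      using sbw_relation_eq[OF rel(6)[OF i j that]] i j by (simp only: x s closed flip: sbw_class_mult)
  next
    fix M
    assume M: "\<one>\<^bsub>SBW n\<^esub> \<in> M" "\<zero>\<^bsub>SBW n\<^esub> \<in> M"
      "\<And>u v. u \<in> M \<Longrightarrow> v \<in> M \<Longrightarrow> u \<oplus>\<^bsub>SBW n\<^esub> v \<in> M"
      "\<And>i u. i \<in> {1..n} \<Longrightarrow> u \<in> M \<Longrightarrow> sbw_x n i \<otimes>\<^bsub>SBW n\<^esub> u \<in> M"
      "\<And>i u. i \<in> {1..n} \<Longrightarrow> u \<in> M \<Longrightarrow> sbw_s n i \<otimes>\<^bsub>SBW n\<^esub> u \<in> M"
    let ?M = "{p \<in> carrier (free_alg n). sbw_class n p \<in> M}"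
    have "carrier (free_alg n) \<subseteq> ?M"
      using M by (intro free_alg_generated)
        (auto simp: sbw_class_one sbw_class_zero sbw_class_add sbw_class_mult closed
          free_alg_zero_closed x s simp del: atLeastAtMost_iff)
    then show "carrier (SBW n) \<subseteq> M"
      by (auto elim!: SBW_carrier_cases)
  qed
qed

text \<open>
  Any representative of a class may be used, because the ideal acts by zero.
\<close>

definition sbw_act :: "(gen word \<Rightarrow>\<^sub>0 bit) set \<Rightarrow> (nat set \<Rightarrow> bit) \<Rightarrow> nat set \<Rightarrow> bit"
  where "sbw_act f = act (SOME p. p \<in> f)"

lemma sbw_act_class:
  assumes "p \<in> carrier (free_alg n)"
  shows "sbw_act (sbw_class n p) = act p"
proof -
  interpret I: ideal "sbw_ideal n" "free_alg n" by (rule sbw_ideal_ideal)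
  have "p \<in> sbw_class n p"
    using assms by (rule I.a_rcos_self)
  then have "(SOME q. q \<in> sbw_class n p) \<in> sbw_class n p"
    by (rule someI)
  then obtain r where "r \<in> sbw_ideal n" "(SOME q. q \<in> sbw_class n p) = r + p"
    by (auto simp: a_r_coset_def r_coset_def)
  then show ?thesis
    by (simp add: sbw_act_def fun_eq_iff act_add sbw_ideal_act)
qed

lemma sbw_act_zero [simp]: "sbw_act \<zero>\<^bsub>SBW n\<^esub> \<phi> u = 0"
  by (simp add: sbw_act_class free_alg_zero_closed flip: sbw_class_zero)

lemma sbw_act_one [simp]: "sbw_act \<one>\<^bsub>SBW n\<^esub> \<phi> = \<phi>"
  by (simp add: sbw_act_class free_alg_one_closed flip: sbw_class_one)

lemma sbw_act_add:
  assumes "f \<in> carrier (SBW n)" "g \<in> carrier (SBW n)"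
  shows "sbw_act (f \<oplus>\<^bsub>SBW n\<^esub> g) \<phi> u = sbw_act f \<phi> u + sbw_act g \<phi> u"
  using assms
  by (elim SBW_carrier_cases)
    (simp add: sbw_act_class act_add free_alg_add_closed flip: sbw_class_add)

lemma sbw_act_mult:
  assumes "f \<in> carrier (SBW n)" "g \<in> carrier (SBW n)"
  shows "sbw_act (f \<otimes>\<^bsub>SBW n\<^esub> g) \<phi> = sbw_act f (sbw_act g \<phi>)"
  using assms
  by (elim SBW_carrier_cases)
    (simp add: sbw_act_class act_mult free_alg_mult_closed flip: sbw_class_mult)

lemma sbw_act_x: "i \<in> {1..n} \<Longrightarrow> sbw_act (sbw_x n i) \<phi> u = of_bool (i \<in> u) * \<phi> u"
  unfolding sbw_x_def by (simp only: sbw_act_class free_x_closed act_x)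

lemma sbw_act_s: "i \<in> {1..n} \<Longrightarrow> sbw_act (sbw_s n i) \<phi> u = \<phi> (sym_diff u {i})"
  unfolding sbw_s_def by (simp only: sbw_act_class free_s_closed act_s)

lemma sbw_act_finsum:
  assumes "finite A" "\<And>i. i \<in> A \<Longrightarrow> f i \<in> carrier (SBW n)"
  shows "sbw_act (finsum (SBW n) f A) \<phi> u = (\<Sum>i\<in>A. sbw_act (f i) \<phi> u)"
proof -
  interpret S: ring "SBW n" by (rule SBW_ring)
  show ?thesis using assms
  proof (induction A rule: finite_induct)
    case (insert i A)
    then have "finsum (SBW n) f (insert i A) = f i \<oplus>\<^bsub>SBW n\<^esub> finsum (SBW n) f A"
      by (intro S.finsum_insert) auto
    moreover have "finsum (SBW n) f A \<in> carrier (SBW n)"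
      using insert by (intro S.finsum_closed) auto
    ultimately show ?case
      using insert by (simp add: sbw_act_add)
  qed simp
qed

lemma sbw_act_bit_scale: "sbw_act (bit_scale (SBW n) c f) \<phi> u = c * sbw_act f \<phi> u"
  by (cases c) (simp_all add: bit_scale_def)

lemma sbw_act_diagonal_prod:
  assumes "finite A" "\<And>i. i \<in> A \<Longrightarrow> f i \<in> carrier (SBW n)"
    and "\<And>i \<phi> u. i \<in> A \<Longrightarrow> sbw_act (f i) \<phi> u = of_bool (P i u) * \<phi> u"
  shows "sbw_act (ordered_prod (SBW n) f A) \<phi> u = of_bool (\<forall>i\<in>A. P i u) * \<phi> u"
proof -
  interpret S: ring "SBW n" by (rule SBW_ring)
  have "sbw_act (foldr (\<lambda>i y. f i \<otimes>\<^bsub>SBW n\<^esub> y) js \<one>\<^bsub>SBW n\<^esub>) \<phi> u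
    = of_bool (\<forall>i\<in>set js. P i u) * \<phi> u" if "set js \<subseteq> A" for js
    using that
  proof (induction js)
    case (Cons j js)
    have "foldr (\<lambda>i y. f i \<otimes>\<^bsub>SBW n\<^esub> y) js \<one>\<^bsub>SBW n\<^esub> \<in> carrier (SBW n)"
      using Cons.prems assms(2) by (intro S.foldr_closed) auto
    with Cons assms(2,3) show ?case by (simp add: sbw_act_mult)
  qed simp
  from this[of "sorted_list_of_set A"] show ?thesis
    using assms(1) by (simp add: ordered_prod_def)
qed

lemma sbw_act_s_pow:
  assumes "b \<subseteq> {1..n}"
  shows "sbw_act (s_pow n b) \<phi> u = \<phi> (sym_diff u b)"
proof -
  interpret shifted_boole_weyl "SBW n" "{1..n}" "sbw_x n" "sbw_s n"
    by (rule SBW_shifted_boole_weyl)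
  have "finite b" using assms by (rule finite_index)
  then show ?thesis using assms
  proof (induction b arbitrary: u rule: finite_induct)
    case empty
    then show ?case by (simp add: s_pow_def)
  next
    case (insert i b)
    have i: "i \<in> {1..n}" "b \<subseteq> {1..n}" using insert by auto
    have "sym_diff (sym_diff u {i}) b = sym_diff u (insert i b)"
      using insert by auto
    with i insert sp_insert[of i b] show ?case
      by (simp add: s_pow_def sbw_act_mult sbw_act_s del: atLeastAtMost_iff)
  qed
qed

lemma sbw_act_x_pow:
  assumes "a \<subseteq> {1..n}"
  shows "sbw_act (x_pow n a) \<phi> u = of_bool (a \<subseteq> u) * \<phi> u"
proof -
  interpret shifted_boole_weyl "SBW n" "{1..n}" "sbw_x n" "sbw_s n"
    by (rule SBW_shifted_boole_weyl)
  have "sbw_act (x_pow n a) \<phi> u = of_bool (\<forall>i\<in>a. i \<in> u) * \<phi> u"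
    unfolding x_pow_def using assms
    by (intro sbw_act_diagonal_prod finite_index x_closed sbw_act_x) auto
  then show ?thesis by (simp add: subset_iff Ball_def)
qed

lemma sbw_act_m_pow:
  assumes "a \<subseteq> {1..n}" "u \<subseteq> {1..n}"
  shows "sbw_act (m_pow n a) \<phi> u = of_bool (u = a) * \<phi> u"
proof -
  interpret shifted_boole_weyl "SBW n" "{1..n}" "sbw_x n" "sbw_s n"
    by (rule SBW_shifted_boole_weyl)
  let ?y = "\<lambda>i. sbw_x n i \<oplus>\<^bsub>SBW n\<^esub> \<one>\<^bsub>SBW n\<^esub>"
  have y: "sbw_act (?y i) \<phi> v = of_bool (i \<notin> v) * \<phi> v" if "i \<in> {1..n}" for i \<phi> v
    using that by (simp add: sbw_act_add sbw_act_x del: atLeastAtMost_iff)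
  have "sbw_act (ordered_prod (SBW n) ?y ({1..n} - a)) \<phi> v
    = of_bool (\<forall>i\<in>{1..n} - a. i \<notin> v) * \<phi> v" for v
    by (intro sbw_act_diagonal_prod y) auto
  moreover have "ordered_prod (SBW n) ?y ({1..n} - a) \<in> carrier (SBW n)"
    by (intro ordered_prod_closed) auto
  ultimately have "sbw_act (m_pow n a) \<phi> u
    = of_bool (a \<subseteq> u) * (of_bool (\<forall>i\<in>{1..n} - a. i \<notin> u) * \<phi> u)"
    using assms by (simp add: m_pow_def sbw_act_mult sbw_act_x_pow[unfolded x_pow_def])
  also have "\<dots> = of_bool (u = a) * \<phi> u"
    using assms by auto
  finally show ?thesis .
qed

section \<open>Subset sums and parity\<close>

text \<open>
  The top term of \<open>sum F (Pow a)\<close> is \<open>F a\<close>, and the other terms belong to proper subsets of \<open>a\<close>: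
  the system is triangular.
\<close>

lemma subset_sum_injective:
  fixes F G :: "'a set \<Rightarrow> 'b::cancel_comm_monoid_add"
  assumes "finite N" "\<And>u. u \<subseteq> N \<Longrightarrow> sum F (Pow u) = sum G (Pow u)" "a \<subseteq> N"
  shows "F a = G a"
proof -
  have "finite a" using assms(1,3) by (rule rev_finite_subset)
  then show ?thesis using assms(3)
  proof (induction a rule: finite_psubset_induct)
    case (psubset a)
    have "sum H (Pow a) = H a + sum H (Pow a - {a})" for H :: "'a set \<Rightarrow> 'b"
      using psubset.hyps by (intro sum.remove) auto
    moreover have "sum F (Pow a - {a}) = sum G (Pow a - {a})"
      using psubset by (intro sum.cong) auto
    ultimately show ?case
      using assms(2)[OF psubset.prems] by simp
  qed
qed

lemma odd_card_eq_sum: "finite A \<Longrightarrow> odd_card A = (\<Sum>k\<in>A. 1)"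
proof (induction A rule: finite_induct)
  case (insert k A)
  then show ?case
    by (cases "odd_card A") (auto simp: odd_card_def split: if_splits)
qed (simp add: odd_card_def)

lemma sum_odd_card_fibres:
  assumes "finite K" "finite E"
  shows "(\<Sum>e\<in>E. odd_card {k \<in> K. g k = e}) = odd_card {k \<in> K. g k \<in> E}"
proof -
  have "odd_card {k \<in> K. g k \<in> E} = (\<Sum>e\<in>E. \<Sum>k\<in>{k \<in> {k \<in> K. g k \<in> E}. g k = e}. 1)"
    using assms by (subst sum.group) (auto simp: odd_card_eq_sum)
  also have "\<dots> = (\<Sum>e\<in>E. odd_card {k \<in> K. g k = e})"
  proof (rule sum.cong)
    fix e assume "e \<in> E"
    then have "{k \<in> {k \<in> K. g k \<in> E}. g k = e} = {k \<in> K. g k = e}" by auto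
    moreover have "finite {k \<in> K. g k = e}" using assms by simp
    ultimately show "(\<Sum>k\<in>{k \<in> {k \<in> K. g k \<in> E}. g k = e}. 1) = odd_card {k \<in> K. g k = e}"
      by (simp only: odd_card_eq_sum)
  qed simp
  finally show ?thesis by simp
qed

text \<open>
  A set \<open>k\<close> that is counted must contain \<open>c - u\<close> and is then free on \<open>b \<inter> c \<inter> u\<close>. So the number of
  choices is \<open>0\<close> or a power of two, and it is odd exactly when a choice exists and is unique. This
  means that each element of \<open>c\<close> lies in exactly one of \<open>u\<close> and \<open>b\<close>.
\<close>

lemma odd_card_deletions:
  assumes "finite c"
  shows "odd_card {k. k \<subseteq> b \<inter> c \<and> c - k \<subseteq> u} = of_bool (c \<subseteq> sym_diff u b)"
proof (cases "c - u \<subseteq> b")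
  case True
  let ?free = "b \<inter> c \<inter> u"
  have "{k. k \<subseteq> b \<inter> c \<and> c - k \<subseteq> u} = (\<lambda>j. j \<union> (c - u)) ` Pow ?free" (is "?K = _")
  proof
    show "?K \<subseteq> (\<lambda>j. j \<union> (c - u)) ` Pow ?free"
    proof
      fix k assume k: "k \<in> ?K"
      then have "k = (k \<inter> u) \<union> (c - u)" "k \<inter> u \<in> Pow ?free" by auto
      then show "k \<in> (\<lambda>j. j \<union> (c - u)) ` Pow ?free" by (rule image_eqI)
    qed
  qed (use True in auto)
  moreover have "inj_on (\<lambda>j. j \<union> (c - u)) (Pow ?free)"
    by (intro inj_onI) auto
  ultimately have "card ?K = card (Pow ?free)"
    by (simp only: card_image)
  also have "\<dots> = 2 ^ card ?free"
    by (rule card_Pow) (use assms in simp)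
  finally have "card ?K = 2 ^ card ?free" .
  moreover have "card ?free = 0 \<longleftrightarrow> c \<subseteq> sym_diff u b"
    using assms True by auto
  ultimately show ?thesis
    by (simp add: odd_card_def)
next
  case False
  then have "{k. k \<subseteq> b \<inter> c \<and> c - k \<subseteq> u} = {}" "\<not> c \<subseteq> sym_diff u b" by auto
  then show ?thesis by (simp only: odd_card_def) simp
qed

section \<open>Coordinates\<close>

abbreviation ms_elem :: "nat \<Rightarrow> nat set \<Rightarrow> nat set \<Rightarrow> (gen word \<Rightarrow>\<^sub>0 bit) set"
  where "ms_elem n a b \<equiv> m_pow n a \<otimes>\<^bsub>SBW n\<^esub> s_pow n b"

abbreviation xs_elem :: "nat \<Rightarrow> nat set \<Rightarrow> nat set \<Rightarrow> (gen word \<Rightarrow>\<^sub>0 bit) set"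
  where "xs_elem n a b \<equiv> x_pow n a \<otimes>\<^bsub>SBW n\<^esub> s_pow n b"

abbreviation SBW_comb ::
  "nat \<Rightarrow> (nat set \<Rightarrow> nat set \<Rightarrow> (gen word \<Rightarrow>\<^sub>0 bit) set) \<Rightarrow> (nat set \<times> nat set \<Rightarrow> bit)
    \<Rightarrow> (gen word \<Rightarrow>\<^sub>0 bit) set"
  where "SBW_comb n \<equiv> char_two_ring.lin_comb (SBW n) {1..n}"

lemma SBW_char_two_ring: "char_two_ring (SBW n) {1..n}"
  by (rule shifted_boole_weyl.axioms[OF SBW_shifted_boole_weyl])

lemma pow_closed:
  assumes "a \<subseteq> {1..n}"
  shows "x_pow n a \<in> carrier (SBW n)" "s_pow n a \<in> carrier (SBW n)" "m_pow n a \<in> carrier (SBW n)"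
proof -
  interpret shifted_boole_weyl "SBW n" "{1..n}" "sbw_x n" "sbw_s n"
    by (rule SBW_shifted_boole_weyl)
  show "x_pow n a \<in> carrier (SBW n)" "s_pow n a \<in> carrier (SBW n)"
    unfolding x_pow_def s_pow_def by (intro xp_closed sp_closed assms)+
  show "m_pow n a \<in> carrier (SBW n)"
    unfolding m_pow_def mp_eq_lp[OF assms] by (rule lp_closed) auto
qed

lemma sbw_act_comb:
  assumes "\<And>a b. a \<subseteq> {1..n} \<Longrightarrow> b \<subseteq> {1..n} \<Longrightarrow> B a b \<in> carrier (SBW n)"
  shows "sbw_act (SBW_comb n B F) \<phi> u
    = (\<Sum>a\<in>Pow {1..n}. \<Sum>b\<in>Pow {1..n}. F (a, b) * sbw_act (B a b) \<phi> u)"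
proof -
  interpret char_two_ring "SBW n" "{1..n}" by (rule SBW_char_two_ring)
  show ?thesis
    unfolding lin_comb_def
  proof (subst sbw_act_finsum)
    show "(\<Oplus>\<^bsub>SBW n\<^esub>b\<in>Pow {1..n}. bit_scale (SBW n) (F (a, b)) (B a b)) \<in> carrier (SBW n)"
      if "a \<in> Pow {1..n}" for a
      using that assms by (intro finsum_closed) auto
    have "sbw_act (\<Oplus>\<^bsub>SBW n\<^esub>b\<in>Pow {1..n}. bit_scale (SBW n) (F (a, b)) (B a b)) \<phi> u
      = (\<Sum>b\<in>Pow {1..n}. F (a, b) * sbw_act (B a b) \<phi> u)" if "a \<in> Pow {1..n}" for a
      using that assms by (subst sbw_act_finsum) (auto simp: sbw_act_bit_scale)
    then show "(\<Sum>a\<in>Pow {1..n}.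
        sbw_act (\<Oplus>\<^bsub>SBW n\<^esub>b\<in>Pow {1..n}. bit_scale (SBW n) (F (a, b)) (B a b)) \<phi> u)
      = (\<Sum>a\<in>Pow {1..n}. \<Sum>b\<in>Pow {1..n}. F (a, b) * sbw_act (B a b) \<phi> u)"
      by (rule sum.cong[OF refl])
  qed simp
qed

text \<open>
  Spanning gives existence and injectivity gives uniqueness of the function that the definite
  description in \<^const>\<open>coords\<close> selects. A combination sees only the values on pairs of subsets of
  \<open>{1..n}\<close>, so any coefficient function can be made extensional.
\<close>

lemma coords_of_basis:
  assumes "\<And>a b. a \<subseteq> {1..n} \<Longrightarrow> b \<subseteq> {1..n} \<Longrightarrow> B a b \<in> carrier (SBW n)"
    and "f \<in> range (SBW_comb n B)"
    and inj: "\<And>F G a b. SBW_comb n B F = SBW_comb n B G \<Longrightarrow> a \<subseteq> {1..n} \<Longrightarrow> b \<subseteq> {1..n}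
      \<Longrightarrow> F (a, b) = G (a, b)"
  shows "f = SBW_comb n B (coords n B f)"
proof -
  interpret char_two_ring "SBW n" "{1..n}" by (rule SBW_char_two_ring)
  let ?D = "Pow {1..n} \<times> Pow {1..n}"
  obtain F where F: "f = lin_comb B F" using assms(2) by auto
  have "lin_comb B (restrict F ?D) = lin_comb B F"
    unfolding lin_comb_def using assms(1)
    by (intro finsum_cong') (auto intro!: finsum_cong' finsum_closed)
  then have exists: "restrict F ?D \<in> ?D \<rightarrow>\<^sub>E UNIV \<and> f = lin_comb B (restrict F ?D)"
    using F by simp
  have unique: "G = H" if G: "G \<in> ?D \<rightarrow>\<^sub>E UNIV \<and> f = lin_comb B G"
    and H: "H \<in> ?D \<rightarrow>\<^sub>E UNIV \<and> f = lin_comb B H" for G H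
  proof (rule PiE_ext[OF conjunct1[OF G] conjunct1[OF H]])
    fix p assume "p \<in> ?D"
    then have "fst p \<subseteq> {1..n}" "snd p \<subseteq> {1..n}" by (simp_all add: mem_Times_iff)
    from inj[OF trans[OF conjunct2[OF G, symmetric] conjunct2[OF H]] this]
    show "G p = H p" by simp
  qed
  have "\<exists>!G. G \<in> ?D \<rightarrow>\<^sub>E UNIV \<and> f = lin_comb B G"
    by (rule ex1I) (rule exists, erule unique[OF _ exists])
  from theI'[OF this] show ?thesis
    unfolding coords_def lin_comb_def by (rule conjunct2)
qed

lemma sym_diff_left_cancel: "sym_diff u b = sym_diff u c \<longleftrightarrow> b = c"
  by auto

text \<open>
  Used with point functions: the shift by \<open>b\<close> carries \<open>u\<close> to the point \<open>u + c\<close> only if \<open>b = c\<close>, so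
  applying an element to a point function picks out one of its coefficients.
\<close>

lemma sum_delta_sym_diff:
  fixes n :: nat and F :: "nat set \<Rightarrow> bit"
  assumes "c \<subseteq> {1..n}"
  shows "(\<Sum>b\<in>Pow {1..n}. F b * of_bool (sym_diff u b = sym_diff u c)) = F c"
proof -
  have "(\<Sum>b\<in>Pow {1..n}. F b * of_bool (sym_diff u b = sym_diff u c))
      = (\<Sum>b\<in>Pow {1..n}. if b = c then F b else 0)"
    unfolding sym_diff_left_cancel by (intro sum.cong) auto
  also have "\<dots> = F c" using assms by simp
  finally show ?thesis .
qed

lemma sbw_act_ms_comb:
  assumes "u \<subseteq> {1..n}"
  shows "sbw_act (SBW_comb n (ms_elem n) F) \<phi> u = (\<Sum>b\<in>Pow {1..n}. F (u, b) * \<phi> (sym_diff u b))"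
proof -
  interpret S: ring "SBW n" by (rule SBW_ring)
  have "sbw_act (ms_elem n a b) \<phi> u = of_bool (u = a) * \<phi> (sym_diff u b)"
    if "a \<subseteq> {1..n}" "b \<subseteq> {1..n}" for a b
    using that assms by (simp add: sbw_act_mult pow_closed sbw_act_m_pow sbw_act_s_pow)
  then have "sbw_act (SBW_comb n (ms_elem n) F) \<phi> u
    = (\<Sum>a\<in>Pow {1..n}. \<Sum>b\<in>Pow {1..n}. F (a, b) * (of_bool (u = a) * \<phi> (sym_diff u b)))"
    by (subst sbw_act_comb) (auto simp: pow_closed intro!: sum.cong)
  also have "\<dots> = (\<Sum>a\<in>Pow {1..n}.
      if u = a then (\<Sum>b\<in>Pow {1..n}. F (a, b) * \<phi> (sym_diff u b)) else 0)"
    by (intro sum.cong) auto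
  also have "\<dots> = (\<Sum>b\<in>Pow {1..n}. F (u, b) * \<phi> (sym_diff u b))"
    using assms by simp
  finally show ?thesis .
qed

lemma sbw_act_xs_comb:
  assumes "u \<subseteq> {1..n}"
  shows "sbw_act (SBW_comb n (xs_elem n) F) \<phi> u
    = (\<Sum>b\<in>Pow {1..n}. (\<Sum>a\<in>Pow u. F (a, b)) * \<phi> (sym_diff u b))"
proof -
  interpret S: ring "SBW n" by (rule SBW_ring)
  have "sbw_act (xs_elem n a b) \<phi> u = of_bool (a \<subseteq> u) * \<phi> (sym_diff u b)"
    if "a \<subseteq> {1..n}" "b \<subseteq> {1..n}" for a b
    using that assms by (simp add: sbw_act_mult pow_closed sbw_act_x_pow sbw_act_s_pow)
  then have "sbw_act (SBW_comb n (xs_elem n) F) \<phi> u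
    = (\<Sum>a\<in>Pow {1..n}. \<Sum>b\<in>Pow {1..n}. F (a, b) * (of_bool (a \<subseteq> u) * \<phi> (sym_diff u b)))"
    by (subst sbw_act_comb) (auto simp: pow_closed intro!: sum.cong)
  also have "\<dots> = (\<Sum>b\<in>Pow {1..n}. \<Sum>a\<in>Pow {1..n}.
      F (a, b) * (of_bool (a \<subseteq> u) * \<phi> (sym_diff u b)))"
    by (rule sum.swap)
  also have "\<dots> = (\<Sum>b\<in>Pow {1..n}. \<Sum>a\<in>Pow u. F (a, b) * \<phi> (sym_diff u b))"
    using assms by (intro sum.cong refl sum.mono_neutral_cong_right) auto
  finally show ?thesis by (simp add: sum_distrib_right)
qed

abbreviation point :: "'a \<Rightarrow> 'a \<Rightarrow> bit"
  where "point v w \<equiv> of_bool (w = v)"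

text \<open>
  A coefficient can be recovered by evaluating the action on a point function. Thus the spanning
  family is linearly independent, and the coordinates do reproduce the element.
\<close>

lemma ms_comb:
  assumes "f \<in> carrier (SBW n)"
  shows "f = SBW_comb n (ms_elem n) (\<lambda>(a, b). coord_ms n f a b)"
proof -
  interpret shifted_boole_weyl "SBW n" "{1..n}" "sbw_x n" "sbw_s n"
    by (rule SBW_shifted_boole_weyl)
  have "f \<in> range (lin_comb (ms_elem n))"
    using assms ms_span unfolding m_pow_def s_pow_def by blast
  moreover have "F (a, b) = G (a, b)"
    if "lin_comb (ms_elem n) F = lin_comb (ms_elem n) G" "a \<subseteq> {1..n}" "b \<subseteq> {1..n}" for F G a b
  proof -
    have "sbw_act (lin_comb (ms_elem n) H) (point (sym_diff a b)) a = H (a, b)" for H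
      unfolding sbw_act_ms_comb[OF that(2)] by (rule sum_delta_sym_diff[OF that(3)])
    with that(1) show ?thesis by metis
  qed
  ultimately have "f = lin_comb (ms_elem n) (coords n (ms_elem n) f)"
    by (intro coords_of_basis) (auto simp: pow_closed)
  then show ?thesis by (simp add: coord_ms_def)
qed

text \<open>
  Here evaluating on point functions recovers only the sums of the coefficients over all subsets of
  \<open>u\<close>; these sums determine the coefficients by triangularity.
\<close>

lemma xs_comb:
  assumes "f \<in> carrier (SBW n)"
  shows "f = SBW_comb n (xs_elem n) (\<lambda>(a, b). coord_xs n f a b)"
proof -
  interpret shifted_boole_weyl "SBW n" "{1..n}" "sbw_x n" "sbw_s n"
    by (rule SBW_shifted_boole_weyl)
  have "f \<in> range (lin_comb (xs_elem n))"
    using assms xs_span unfolding x_pow_def s_pow_def by blast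
  moreover have "F (a, b) = G (a, b)"
    if "lin_comb (xs_elem n) F = lin_comb (xs_elem n) G" "a \<subseteq> {1..n}" "b \<subseteq> {1..n}" for F G a b
  proof -
    have "sbw_act (lin_comb (xs_elem n) H) (point (sym_diff u b)) u = (\<Sum>a\<in>Pow u. H (a, b))"
      if "u \<subseteq> {1..n}" for H u
      unfolding sbw_act_xs_comb[OF that] by (rule sum_delta_sym_diff) fact
    with that(1) have "(\<Sum>a\<in>Pow u. F (a, b)) = (\<Sum>a\<in>Pow u. G (a, b))" if "u \<subseteq> {1..n}" for u
      using that by metis
    then show ?thesis
      by (rule subset_sum_injective[OF finite_atLeastAtMost _ that(2)])
  qed
  ultimately have "f = lin_comb (xs_elem n) (coords n (xs_elem n) f)"
    by (intro coords_of_basis) (auto simp: pow_closed)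
  then show ?thesis by (simp add: coord_xs_def)
qed

lemma sbw_act_coord_ms:
  assumes "f \<in> carrier (SBW n)" "u \<subseteq> {1..n}"
  shows "sbw_act f \<phi> u = (\<Sum>b\<in>Pow {1..n}. coord_ms n f u b * \<phi> (sym_diff u b))"
  using arg_cong[OF ms_comb[OF assms(1)], of "\<lambda>f. sbw_act f \<phi> u"]
  unfolding sbw_act_ms_comb[OF assms(2)] by simp

text \<open>
  A point function is a basis vector: this is the entry of the matrix of \<open>f\<close> in row \<open>a\<close> and column
  \<open>a + b\<close>.
\<close>

lemma coord_ms_eq_act:
  assumes "f \<in> carrier (SBW n)" "a \<subseteq> {1..n}" "b \<subseteq> {1..n}"
  shows "coord_ms n f a b = sbw_act f (point (sym_diff a b)) a"
  unfolding sbw_act_coord_ms[OF assms(1,2)] by (rule sum_delta_sym_diff[OF assms(3), symmetric])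

text \<open>
  Change of basis: the monomial \<open>x\<^sup>a\<close> is the sum of the minterms \<open>m\<^sup>u\<close> with \<open>a \<subseteq> u\<close>.
\<close>

lemma coord_ms_eq_sum_coord_xs:
  assumes "f \<in> carrier (SBW n)" "u \<subseteq> {1..n}" "b \<subseteq> {1..n}"
  shows "coord_ms n f u b = (\<Sum>a\<in>Pow u. coord_xs n f a b)"
proof -
  have "coord_ms n f u b = sbw_act (SBW_comb n (xs_elem n) (\<lambda>(a, b). coord_xs n f a b))
      (point (sym_diff u b)) u"
    using coord_ms_eq_act[OF assms] xs_comb[OF assms(1)] by simp
  also have "\<dots> = (\<Sum>a\<in>Pow u. coord_xs n f a b)"
    unfolding sbw_act_xs_comb[OF assms(2)] by (subst sum_delta_sym_diff[OF assms(3)]) simp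
  finally show ?thesis .
qed

section \<open>The product formulas\<close>

text \<open>
  The coordinates are matrix entries and the product acts by composition, so this is matrix
  multiplication, with rows and columns described by a point and a shift.
\<close>

lemma coord_ms_mult:
  assumes "f \<in> carrier (SBW n)" "g \<in> carrier (SBW n)" "a \<subseteq> {1..n}" "b \<subseteq> {1..n}"
  shows "coord_ms n (f \<otimes>\<^bsub>SBW n\<^esub> g) a b =
    (\<Sum>c\<in>Pow {1..n}. coord_ms n f a c * coord_ms n g (sym_diff a c) (sym_diff b c))"
proof -
  interpret S: ring "SBW n" by (rule SBW_ring)
  have "coord_ms n (f \<otimes>\<^bsub>SBW n\<^esub> g) a b = sbw_act f (sbw_act g (point (sym_diff a b))) a"
    using assms by (simp add: coord_ms_eq_act sbw_act_mult)
  also have "\<dots> = (\<Sum>c\<in>Pow {1..n}.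
      coord_ms n f a c * sbw_act g (point (sym_diff a b)) (sym_diff a c))"
    by (rule sbw_act_coord_ms[OF assms(1,3)])
  also have "\<dots> = (\<Sum>c\<in>Pow {1..n}. coord_ms n f a c * coord_ms n g (sym_diff a c) (sym_diff b c))"
  proof (intro sum.cong refl arg_cong2[where f = "(*)"])
    fix c assume "c \<in> Pow {1..n}"
    then have "sym_diff a c \<subseteq> {1..n}" "sym_diff b c \<subseteq> {1..n}" using assms(3,4) by auto
    moreover have "sym_diff (sym_diff a c) (sym_diff b c) = sym_diff a b" by auto
    ultimately show "sbw_act g (point (sym_diff a b)) (sym_diff a c)
      = coord_ms n g (sym_diff a c) (sym_diff b c)"
      using coord_ms_eq_act[OF assms(2)] by metis
  qed
  finally show ?thesis .
qed

text \<open>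
  Both sides are compared after summing over all subsets \<open>e\<close> of an arbitrary \<open>u\<close>. On the left the sum
  is an \<open>ms\<close>-coordinate of the product, known by the first formula. On the right it acts on the
  parity alone and turns it into the condition \<open>a \<subseteq> u\<close> and \<open>c \<subseteq> u + b\<close>, which is exactly the range of
  the two sums that convert \<open>xs\<close>-coordinates of the factors into \<open>ms\<close>-coordinates.
\<close>

lemma coord_xs_mult:
  assumes f: "f \<in> carrier (SBW n)" and g: "g \<in> carrier (SBW n)"
    and e: "e \<subseteq> {1..n}" and h: "h \<subseteq> {1..n}"
  shows "coord_xs n (f \<otimes>\<^bsub>SBW n\<^esub> g) e h =
    (\<Sum>a\<in>{a \<in> Pow {1..n}. a \<subseteq> e}. \<Sum>b\<in>Pow {1..n}. \<Sum>c\<in>Pow {1..n}.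
      odd_card {k. k \<subseteq> b \<inter> c \<and> a \<union> (c - k) = e} * coord_xs n f a b * coord_xs n g c (sym_diff b h))"
proof -
  interpret S: ring "SBW n" by (rule SBW_ring)
  let ?P = "Pow {1..n}"
  let ?K = "\<lambda>a b c e. odd_card {k. k \<subseteq> b \<inter> c \<and> a \<union> (c - k) = e}"
  let ?f = "coord_xs n f" and ?g = "coord_xs n g"
  \<comment> \<open>The condition \<open>a \<subseteq> e\<close> is forced by \<open>a \<union> (c - k) = e\<close>; dropping it frees the sums from \<open>e\<close>.\<close>
  have restrict: "(\<Sum>a\<in>{a \<in> ?P. a \<subseteq> e}. \<Sum>b\<in>?P. \<Sum>c\<in>?P. ?K a b c e * ?f a b * ?g c (sym_diff b h))
      = (\<Sum>a\<in>?P. \<Sum>b\<in>?P. \<Sum>c\<in>?P. ?K a b c e * ?f a b * ?g c (sym_diff b h))" for e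
  proof (rule sum.mono_neutral_left)
    have "?K a b c e = 0" if "\<not> a \<subseteq> e" for a b c
    proof -
      have "{k. k \<subseteq> b \<inter> c \<and> a \<union> (c - k) = e} = {}" using that by auto
      then show ?thesis by (simp only: odd_card_def) simp
    qed
    then show "\<forall>a\<in>?P - {a \<in> ?P. a \<subseteq> e}.
        (\<Sum>b\<in>?P. \<Sum>c\<in>?P. ?K a b c e * ?f a b * ?g c (sym_diff b h)) = 0"
      by simp
  qed auto
  have "coord_xs n (f \<otimes>\<^bsub>SBW n\<^esub> g) e h
      = (\<Sum>a\<in>?P. \<Sum>b\<in>?P. \<Sum>c\<in>?P. ?K a b c e * ?f a b * ?g c (sym_diff b h))"
  proof (rule subset_sum_injective[OF finite_atLeastAtMost _ e])
    fix u :: "nat set" assume u: "u \<subseteq> {1..n}"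
    then have fin: "finite u" by (rule finite_subset) simp
    have parity: "(\<Sum>e\<in>Pow u. ?K a b c e) = of_bool (a \<subseteq> u) * of_bool (c \<subseteq> sym_diff u b)"
      if "c \<in> ?P" for a b c
    proof -
      have c: "finite c" using that by (auto intro: finite_subset)
      then have "finite {k. k \<subseteq> b \<inter> c}" by simp
      from sum_odd_card_fibres[OF this, of "Pow u" "\<lambda>k. a \<union> (c - k)"] fin
      have "(\<Sum>e\<in>Pow u. ?K a b c e) = odd_card {k. k \<subseteq> b \<inter> c \<and> a \<union> (c - k) \<subseteq> u}"
        by simp
      also have "\<dots> = of_bool (a \<subseteq> u) * of_bool (c \<subseteq> sym_diff u b)"
        using odd_card_deletions[OF c, of b u] by (cases "a \<subseteq> u") (simp_all add: odd_card_def)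
      finally show ?thesis .
    qed
    have "(\<Sum>e\<in>Pow u. coord_xs n (f \<otimes>\<^bsub>SBW n\<^esub> g) e h) = coord_ms n (f \<otimes>\<^bsub>SBW n\<^esub> g) u h"
      using f g u h by (simp add: coord_ms_eq_sum_coord_xs)
    also have "\<dots> = (\<Sum>b\<in>?P. coord_ms n f u b * coord_ms n g (sym_diff u b) (sym_diff b h))"
      unfolding coord_ms_mult[OF f g u h] by (simp only: Un_commute)
    also have "\<dots> = (\<Sum>b\<in>?P. (\<Sum>a\<in>Pow u. ?f a b) * (\<Sum>c\<in>Pow (sym_diff u b). ?g c (sym_diff b h)))"
    proof (intro sum.cong refl arg_cong2[where f = "(*)"])
      fix b assume b: "b \<in> ?P"
      then show "coord_ms n f u b = (\<Sum>a\<in>Pow u. ?f a b)"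
        by (intro coord_ms_eq_sum_coord_xs f u) auto
      from b show "coord_ms n g (sym_diff u b) (sym_diff b h)
          = (\<Sum>c\<in>Pow (sym_diff u b). ?g c (sym_diff b h))"
        using u h by (intro coord_ms_eq_sum_coord_xs g) auto
    qed
    also have "\<dots> = (\<Sum>b\<in>?P. (\<Sum>a\<in>?P. of_bool (a \<subseteq> u) * ?f a b) *
        (\<Sum>c\<in>?P. of_bool (c \<subseteq> sym_diff u b) * ?g c (sym_diff b h)))"
      using u by (intro sum.cong refl arg_cong2[where f = "(*)"] sum.mono_neutral_cong_left) auto
    also have "\<dots> = (\<Sum>b\<in>?P. \<Sum>a\<in>?P. \<Sum>c\<in>?P.
        (\<Sum>e\<in>Pow u. ?K a b c e) * ?f a b * ?g c (sym_diff b h))"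
      unfolding sum_product by (intro sum.cong refl) (simp only: parity mult_ac)
    also have "\<dots> = (\<Sum>a\<in>?P. \<Sum>b\<in>?P. \<Sum>c\<in>?P. \<Sum>e\<in>Pow u.
        ?K a b c e * ?f a b * ?g c (sym_diff b h))"
      unfolding sum_distrib_right by (rule sum.swap)
    also have "\<dots> = (\<Sum>e\<in>Pow u. \<Sum>a\<in>?P. \<Sum>b\<in>?P. \<Sum>c\<in>?P.
        ?K a b c e * ?f a b * ?g c (sym_diff b h))"
      unfolding sum.swap[of _ "Pow u" ?P] ..
    finally show "(\<Sum>e\<in>Pow u. coord_xs n (f \<otimes>\<^bsub>SBW n\<^esub> g) e h) = \<dots>" .
  qed
  then show ?thesis unfolding restrict .
qed

theorem theorem31:
  fixes n :: nat and f g :: "(gen word \<Rightarrow>\<^sub>0 bit) set" and a b e h :: "nat set"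
  assumes "n \<ge> 1"
    and "f \<in> carrier (SBW n)" and "g \<in> carrier (SBW n)"
    and "a \<in> Pow {1..n}" and "b \<in> Pow {1..n}" and "e \<in> Pow {1..n}" and "h \<in> Pow {1..n}"
  shows "coord_ms n (f \<otimes>\<^bsub>SBW n\<^esub> g) a b =
      (\<Sum>c \<in> Pow {1..n}. coord_ms n f a c * coord_ms n g (sym_diff a c) (sym_diff b c))
    \<and> coord_xs n (f \<otimes>\<^bsub>SBW n\<^esub> g) e h =
      (\<Sum>a \<in> {a \<in> Pow {1..n}. a \<subseteq> e}. \<Sum>b \<in> Pow {1..n}. \<Sum>c \<in> Pow {1..n}.
        odd_card {k. k \<subseteq> b \<inter> c \<and> a \<union> (c - k) = e} * coord_xs n f a b * coord_xs n g c (sym_diff b h))"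
  using assms by (intro conjI coord_ms_mult coord_xs_mult) auto

end
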